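(* The following forms are all polystable: $X_1\cdots X_m\in\mathrm{Sym}^m\mathbb{C}^m$; $X_1^D+\cdots+X_m^D\in\mathrm{Sym}^D\mathbb{C}^m$ if $D>1$; the determinant $\det_n\in\mathrm{Sym}^n\mathbb{C}^{n^2}$; and the permanent $\mathrm{per}_n\in\mathrm{Sym}^n\mathbb{C}^{n^2}$ (for all $m,n\ge1$).
   Context: Work over $\mathbb{C}$. $\mathrm{Sym}^D\mathbb{C}^N$ is the space of homogeneous polynomials of degree $D$ in $N$ variables with the natural action of $\mathrm{GL}_N$ by linear substitution. A form $w\in\mathrm{Sym}^D\mathbb{C}^N$ is polystable if its $\mathrm{SL}_N$-orbit is closed. $\det_n=\sum_{\pi\in S_n}\mathrm{sgn}(\pi)X_{1,\pi(1)}\cdots X_{n,\pi(n)}$ and $\mathrm{per}_n=\sum_{\pi\in S_n}X_{1,\pi(1)}\cdots X_{n,\pi(n)}$ are forms of degree $n$ in the $n^2$ variables $X_{i,j}$. *)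

theory Defs
  imports "HOL-Analysis.Analysis" "HOL-Library.Poly_Mapping"
begin

text \<open>
  A polynomial over the complex numbers in variables indexed by \<open>'v\<close> maps exponent vectors to
  coefficients, with finite support; multiplication is the convolution product of
  \<^theory>\<open>HOL-Library.Poly_Mapping\<close>. The number of variables is \<open>CARD('v)\<close>.
\<close>

type_synonym 'v cpoly = "('v \<Rightarrow>\<^sub>0 nat) \<Rightarrow>\<^sub>0 complex"

definition Var :: "'v \<Rightarrow> 'v cpoly" where
  "Var i = Poly_Mapping.single (Poly_Mapping.single i 1) 1"

definition Const :: "complex \<Rightarrow> 'v cpoly" where
  "Const c = Poly_Mapping.single 0 c"

definition Sym :: "nat \<Rightarrow> ('v::finite) cpoly set" where
  "Sym D = {p. \<forall>e \<in> Poly_Mapping.keys p. (\<Sum>i\<in>UNIV. Poly_Mapping.lookup e i) = D}"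

definition subst_poly :: "('v::finite \<Rightarrow> 'v cpoly) \<Rightarrow> 'v cpoly \<Rightarrow> 'v cpoly" where
  "subst_poly \<sigma> p =
     (\<Sum>e \<in> Poly_Mapping.keys p.
        Const (Poly_Mapping.lookup p e) * (\<Prod>i\<in>UNIV. \<sigma> i ^ Poly_Mapping.lookup e i))"

text \<open>
  The variables are the standard basis of the space of linear forms, and a matrix acts on them
  by its columns; this makes \<open>act\<close> a left action of the invertible matrices.
\<close>

definition act :: "complex^'v^'v \<Rightarrow> ('v::finite) cpoly \<Rightarrow> 'v cpoly" where
  "act A p = subst_poly (\<lambda>j. \<Sum>i\<in>UNIV. Const (A $ i $ j) * Var i) p"

definition SL :: "(complex^'v^'v::finite) set" where
  "SL = {A. det A = 1}"

definition SL_orbit :: "('v::finite) cpoly \<Rightarrow> 'v cpoly set" where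
  "SL_orbit p = (\<lambda>A. act A p) ` SL"

text \<open>
  The Euclidean topology on the finite-dimensional space of forms of degree \<open>D\<close>. It is induced
  from the product topology on coefficient functions; as only the finitely many exponent vectors
  of degree \<open>D\<close> matter, this is the usual topology of the coefficient space. An orbit of a linear
  algebraic group is closed in this topology iff it is Zariski closed.
\<close>

definition Sym_topology :: "nat \<Rightarrow> ('v::finite) cpoly topology" where
  "Sym_topology D = pullback_topology (Sym D) Poly_Mapping.lookup euclidean"

definition polystable :: "nat \<Rightarrow> ('v::finite) cpoly \<Rightarrow> bool" where
  "polystable D w \<longleftrightarrow> w \<in> Sym D \<and> closedin (Sym_topology D) (SL_orbit w)"

definition det_poly :: "('n::finite \<times> 'n) cpoly" where
  "det_poly = (\<Sum>\<pi> | \<pi> permutes (UNIV :: 'n set). of_int (sign \<pi>) * (\<Prod>i\<in>UNIV. Var (i, \<pi> i)))"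

definition per_poly :: "('n::finite \<times> 'n) cpoly" where
  "per_poly = (\<Sum>\<pi> | \<pi> permutes (UNIV :: 'n set). \<Prod>i\<in>UNIV. Var (i, \<pi> i))"

end

theory Submission
  imports Defs
begin

text \<open>
  All four forms are critical points of the norm on their orbits, and by a theorem of Kempf and
  Ness such points have closed orbits. Here a form of degree \<open>D\<close> is identified with
  the symmetric tensor of order \<open>D\<close> that it polarises to, tensors carry the
  standard Hermitian inner product, and criticality is the vanishing of the moment map on
  traceless matrices: the Hermitian product of \<open>P T\<close> and \<open>T\<close> is a
  multiple of \<open>trace P\<close>, for all matrices \<open>P\<close> acting as elements of
  the Lie algebra.

  For the given forms this is combinatorics of monomials. A replacement of one factor of a
  monomial by another variable never leads to a monomial of the same form, which kills the
  off-diagonal part of the moment map; and the variables are permuted transitively by symmetries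
  that preserve the absolute values of the coefficients, which makes the diagonal part scalar.
  See \<open>polystable_if_isolated_transitive\<close>.

  Closedness of the orbit of a critical tensor \<open>T\<close> is
  \<open>tensor_orbit_closed\<close>. Suppose that \<open>g n T\<close> converges, where each
  \<open>g n\<close> is chosen as short as possible for its effect on \<open>T\<close>. If the
  \<open>g n\<close> were unbounded, their singular value decompositions would single out a
  limiting diagonal direction \<open>q\<close> of trace zero, in some unitary frame, along which
  \<open>T\<close> does not grow. Criticality says that the weights of \<open>q\<close> on
  \<open>T\<close> average to zero; as none of them is positive, they are all zero. Then
  \<open>q\<close> stabilises \<open>T\<close>, and a step back along \<open>q\<close> shortens
  \<open>g n\<close>, a contradiction. So the \<open>g n\<close> are bounded and have a limit
  point.

  The existence of singular value decompositions is obtained by maximising a function on the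
  unitary group.
\<close>

section \<open>Unitary matrices and singular values\<close>

definition adj :: "complex^'v^'v \<Rightarrow> complex^'v^'v" where
  "adj A = (\<chi> i j. cnj (A $ j $ i))"

definition unitary :: "complex^'v^'v \<Rightarrow> bool" where
  "unitary U \<longleftrightarrow> adj U ** U = mat 1"

definition diag_mat :: "('v \<Rightarrow> complex) \<Rightarrow> complex^'v^'v" where
  "diag_mat d = (\<chi> i j. if i = j then d i else 0)"

lemma adj_nth [simp]: "adj A $ i $ j = cnj (A $ j $ i)"
  by (simp add: adj_def)

lemma adj_adj [simp]: "adj (adj A) = A"
  by (simp add: vec_eq_iff)

lemma adj_mult: "adj (A ** B) = adj B ** adj A"
  by (simp add: vec_eq_iff matrix_matrix_mult_def mult.commute)

lemma adj_mat_1 [simp]: "adj (mat 1) = mat 1"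
  by (simp add: vec_eq_iff mat_def)

lemma adj_diag_mat: "adj (diag_mat d) = diag_mat (\<lambda>i. cnj (d i))"
  by (simp add: vec_eq_iff diag_mat_def)

lemma diag_mat_mult: "diag_mat d ** diag_mat e = diag_mat (\<lambda>i. d i * e i)"
proof -
  have "(\<Sum>k\<in>UNIV. (if i = k then d i else 0) * (if k = j then e k else 0)) =
      (\<Sum>k\<in>UNIV. if k = i then (if i = j then d i * e i else 0) else 0)" for i j
    by (intro sum.cong) auto
  then show ?thesis
    by (simp add: vec_eq_iff diag_mat_def matrix_matrix_mult_def)
qed

lemma diag_mat_1: "diag_mat (\<lambda>i. 1) = mat 1"
  by (simp add: vec_eq_iff diag_mat_def mat_def)

lemma det_diag_mat: "det (diag_mat d) = (\<Prod>i\<in>UNIV. d i)"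
  by (subst det_diagonal) (auto simp: diag_mat_def)

lemma det_adj: "det (adj A) = cnj (det A)"
proof -
  have "det (adj A) = det (transpose (adj A))" by (simp only: det_transpose)
  also have "\<dots> = cnj (det A)"
    by (simp add: det_def transpose_def)
  finally show ?thesis .
qed

lemma unitary_mat_1: "unitary (mat 1)"
  by (simp add: unitary_def)

lemma unitary_right: "unitary U \<Longrightarrow> U ** adj U = mat 1"
  unfolding unitary_def by (simp add: matrix_left_right_inverse)

lemma unitary_adj: "unitary U \<Longrightarrow> unitary (adj U)"
  using unitary_right by (simp add: unitary_def)

lemma unitary_mult: "unitary U \<Longrightarrow> unitary V \<Longrightarrow> unitary (U ** V)"
  unfolding unitary_def adj_mult
  by (metis matrix_mul_assoc matrix_mul_rid)

lemma norm_det_unitary: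
  assumes "unitary U" shows "norm (det U) = 1"
proof -
  have "det (adj U ** U) = 1" using assms by (simp add: unitary_def)
  then have "cnj (det U) * det U = 1" by (simp add: det_mul det_adj)
  then have "norm (det U) * norm (det U) = 1"
    by (metis complex_mod_cnj norm_mult norm_one)
  then show ?thesis
    by (metis abs_norm_cancel abs_square_eq_1 power2_eq_square)
qed

lemma norm_matrix_square: "(norm A)\<^sup>2 = (\<Sum>i\<in>UNIV. \<Sum>j\<in>UNIV. (cmod (A $ i $ j))\<^sup>2)"
  by (simp add: norm_vec_def L2_set_def sum_nonneg)

lemma trace_adj_mult: "trace (adj A ** A) = of_real ((norm A)\<^sup>2)"
proof -
  have "trace (adj A ** A) = (\<Sum>i\<in>UNIV. \<Sum>k\<in>UNIV. of_real ((cmod (A $ k $ i))\<^sup>2))"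
    by (simp add: trace_def matrix_matrix_mult_def complex_norm_square mult.commute del: of_real_power)
  also have "\<dots> = of_real ((norm A)\<^sup>2)"
    unfolding norm_matrix_square of_real_sum by (rule sum.swap)
  finally show ?thesis .
qed

text \<open>
  The norm on matrices is the Frobenius norm, so that \<open>trace_adj_mult\<close> makes it
  invariant under unitary matrices on either side.
\<close>

lemma norm_unitary_mult:
  fixes A :: "complex^'v^'v"
  assumes "unitary U" shows "norm (U ** A) = norm A"
proof -
  have "adj (U ** A) ** (U ** A) = adj A ** A"
    using assms unfolding unitary_def adj_mult
    by (metis matrix_mul_assoc matrix_mul_rid)
  then have "(norm (U ** A))\<^sup>2 = (norm A)\<^sup>2"
    by (metis trace_adj_mult of_real_eq_iff)
  then show ?thesis by simp
qed

lemma norm_adj: "norm (adj A) = norm A"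
proof -
  have "(norm (adj A))\<^sup>2 = (norm A)\<^sup>2"
    unfolding norm_matrix_square by (subst sum.swap) simp
  then show ?thesis by simp
qed

lemma norm_mult_unitary:
  fixes A :: "complex^'v^'v"
  assumes "unitary U" shows "norm (A ** U) = norm A"
  by (metis adj_adj adj_mult assms norm_adj norm_unitary_mult unitary_adj)

lemma tendsto_matrix_mult:
  fixes A :: "'a \<Rightarrow> complex^'v^'v"
  assumes "(A \<longlongrightarrow> A') F" "(B \<longlongrightarrow> B') F"
  shows "((\<lambda>x. A x ** B x) \<longlongrightarrow> A' ** B') F"
  unfolding matrix_matrix_mult_def
  by (intro tendsto_vec_lambda tendsto_sum tendsto_mult tendsto_vec_nth assms)

lemma tendsto_adj:
  assumes "(A \<longlongrightarrow> A') F" shows "((\<lambda>x. adj (A x)) \<longlongrightarrow> adj A') F"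
  unfolding adj_def by (intro tendsto_vec_lambda tendsto_cnj tendsto_vec_nth assms)

lemma compact_unitary: "compact {U :: complex^'v^'v. unitary U}"
proof -
  have "continuous_on UNIV (\<lambda>U :: complex^'v^'v. adj U ** U)"
    unfolding continuous_on_def
    by (intro ballI tendsto_matrix_mult tendsto_adj) (rule tendsto_ident_at)+
  then have "closed {U :: complex^'v^'v. unitary U}"
    unfolding unitary_def by (intro closed_Collect_eq continuous_intros)
  moreover have "norm U = norm (mat 1 :: complex^'v^'v)" if "unitary U" for U :: "complex^'v^'v"
    using norm_unitary_mult[OF that, of "mat 1"] by simp
  then have "bounded {U :: complex^'v^'v. unitary U}"
    unfolding bounded_iff by (intro exI[of _ "norm (mat 1 :: complex^'v^'v)"]) auto
  ultimately show ?thesis by (simp add: compact_eq_bounded_closed)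
qed

definition col_sq :: "complex^'v^'v \<Rightarrow> 'v \<Rightarrow> real" where
  "col_sq M j = (\<Sum>i\<in>UNIV. (cmod (M $ i $ j))\<^sup>2)"

definition rotation :: "'v \<Rightarrow> 'v \<Rightarrow> real \<Rightarrow> complex \<Rightarrow> complex^'v^'v" where
  "rotation p q c z = (\<chi> i j.
     if j = p then (if i = p then of_real c else if i = q then z else 0)
     else if j = q then (if i = p then - cnj z else if i = q then of_real c else 0)
     else if i = j then 1 else 0)"

lemma mult_rotation_nth:
  assumes "p \<noteq> q"
  shows "(M ** rotation p q c z) $ i $ j =
    (if j = p then of_real c * M $ i $ p + z * M $ i $ q
     else if j = q then - cnj z * M $ i $ p + of_real c * M $ i $ q
     else M $ i $ j)"
proof -
  have *: "(\<Sum>k\<in>UNIV. M $ i $ k * (if k = p then a else if k = q then b else 0))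
      = a * M $ i $ p + b * M $ i $ q" for a b
  proof -
    have "(\<Sum>k\<in>UNIV. M $ i $ k * (if k = p then a else if k = q then b else 0)) =
      (\<Sum>k\<in>UNIV. (if k = p then a * M $ i $ p else 0) + (if k = q then b * M $ i $ q else 0))"
      using assms by (intro sum.cong) auto
    then show ?thesis by (simp add: sum.distrib)
  qed
  have **: "(\<Sum>k\<in>UNIV. M $ i $ k * (if k = j then 1 else 0)) = M $ i $ j"
    by (simp add: if_distrib cong: if_cong)
  show ?thesis
    using assms by (auto simp: matrix_matrix_mult_def rotation_def * ** cong: if_cong)
qed

lemma unitary_rotation:
  assumes "p \<noteq> q" "c\<^sup>2 + (cmod z)\<^sup>2 = 1"
  shows "unitary (rotation p q c z)"
proof -
  have zz: "cnj z * z = 1 - (of_real c)\<^sup>2"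
    using assms(2) by (metis add_diff_cancel_left' complex_norm_square mult.commute of_real_1
        of_real_add of_real_power)
  have "(adj (rotation p q c z) ** rotation p q c z) $ i $ j = mat 1 $ i $ j" for i j
    unfolding mult_rotation_nth[OF assms(1)]
    using assms(1) zz by (auto simp: rotation_def mat_def power2_eq_square algebra_simps)
  then show ?thesis by (simp add: unitary_def vec_eq_iff)
qed

lemma cmod_add_square: "(cmod (a + b))\<^sup>2 = (cmod a)\<^sup>2 + (cmod b)\<^sup>2 + 2 * Re (cnj a * b)"
  unfolding cmod_power2 by (simp add: power2_eq_square algebra_simps)

lemma cmod_diff_square: "(cmod (a - b))\<^sup>2 = (cmod a)\<^sup>2 + (cmod b)\<^sup>2 - 2 * Re (cnj a * b)"
  unfolding cmod_power2 by (simp add: power2_eq_square algebra_simps)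

lemma col_sq_rotation:
  assumes "p \<noteq> q" and h: "h = (adj M ** M) $ p $ q"
  shows "col_sq (M ** rotation p q c z) p =
           c\<^sup>2 * col_sq M p + (cmod z)\<^sup>2 * col_sq M q + 2 * c * Re (z * h)"
    and "col_sq (M ** rotation p q c z) q =
           (cmod z)\<^sup>2 * col_sq M p + c\<^sup>2 * col_sq M q - 2 * c * Re (z * h)"
    and "j \<noteq> p \<Longrightarrow> j \<noteq> q \<Longrightarrow> col_sq (M ** rotation p q c z) j = col_sq M j"
proof -
  have zh: "Re (z * h) = (\<Sum>i\<in>UNIV. Re (z * (cnj (M $ i $ p) * M $ i $ q)))"
    unfolding h by (simp add: matrix_matrix_mult_def sum_distrib_left del: times_complex.sel)
  show "col_sq (M ** rotation p q c z) p =
           c\<^sup>2 * col_sq M p + (cmod z)\<^sup>2 * col_sq M q + 2 * c * Re (z * h)"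
    unfolding col_sq_def mult_rotation_nth[OF assms(1)] zh sum_distrib_left sum.distrib[symmetric]
    by (intro sum.cong refl)
      (simp add: cmod_add_square cmod_diff_square norm_mult power_mult_distrib algebra_simps)
  show "col_sq (M ** rotation p q c z) q =
           (cmod z)\<^sup>2 * col_sq M p + c\<^sup>2 * col_sq M q - 2 * c * Re (z * h)"
    unfolding col_sq_def mult_rotation_nth[OF assms(1)] zh sum_distrib_left sum.distrib[symmetric]
      sum_subtractf[symmetric]
    using assms(1)
    by (intro sum.cong refl)
      (simp add: cmod_add_square cmod_diff_square norm_mult power_mult_distrib algebra_simps)
  show "j \<noteq> p \<Longrightarrow> j \<noteq> q \<Longrightarrow> col_sq (M ** rotation p q c z) j = col_sq M j"
    unfolding col_sq_def mult_rotation_nth[OF assms(1)] by simp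
qed

text \<open>
  One step of the one-sided Jacobi iteration. A plane rotation of two columns keeps the sum of
  their squared lengths; if they are not orthogonal, it can be chosen to increase the gap
  between the squared lengths, hence also the sum of the fourth powers of the lengths.
\<close>

lemma jacobi_step:
  assumes pq: "p \<noteq> q" and h0: "(adj M ** M) $ p $ q \<noteq> 0" and XY: "col_sq M q \<le> col_sq M p"
  shows "\<exists>R. unitary R \<and> (\<Sum>j\<in>UNIV. (col_sq M j)\<^sup>2) < (\<Sum>j\<in>UNIV. (col_sq (M ** R) j)\<^sup>2)"
proof -
  define h where "h = (adj M ** M) $ p $ q"
  define X Y where "X = col_sq M p" and "Y = col_sq M q"
  define d b where "d = X - Y" and "b = 2 * cmod h"
  define r where "r = sqrt ((d + 1)\<^sup>2 + b\<^sup>2)"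
  \<comment> \<open>The gap changes from \<open>d\<close> to \<open>(c\<^sup>2 - s\<^sup>2) * d +
    2 * c * s * b\<close>, which exceeds \<open>d\<close> as soon as \<open>c * b > s * d\<close>.
    The vector \<open>(d + 1, b)\<close> has this property; \<open>z\<close> turns
    \<open>h\<close> to the positive axis.\<close>
  define c s where "c = (d + 1) / r" and "s = b / r"
  define z where "z = of_real s * cnj h / of_real (cmod h)"
  have d: "d \<ge> 0" using XY by (simp add: d_def X_def Y_def)
  have b: "b > 0" using h0 by (simp add: b_def h_def)
  have r: "r > 0" using d b unfolding r_def by (intro real_sqrt_gt_zero add_nonneg_pos) auto
  have r2: "r\<^sup>2 = (d + 1)\<^sup>2 + b\<^sup>2" unfolding r_def by (rule real_sqrt_pow2) simp
  have hpos: "cmod h > 0" using b by (simp add: b_def)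
  have s: "s > 0" using b r unfolding s_def by (rule divide_pos_pos)
  have "c\<^sup>2 + s\<^sup>2 = ((d + 1)\<^sup>2 + b\<^sup>2) / r\<^sup>2"
    unfolding c_def s_def power_divide by (rule add_divide_distrib[symmetric])
  then have cs: "c\<^sup>2 + s\<^sup>2 = 1" using r by (simp only: r2[symmetric]) simp
  have zs: "cmod z = s" using hpos s by (simp add: z_def norm_mult norm_divide)
  have "z * h = of_real (s * cmod h)"
  proof -
    have "z * h = of_real s * (h * cnj h) / of_real (cmod h)"
      unfolding z_def by (rule trans[OF times_divide_eq_left]) (simp only: ac_simps)
    also have "h * cnj h = of_real (cmod h) * of_real (cmod h)"
      using complex_norm_square[of h] by (simp only: power2_eq_square of_real_mult)
    finally show ?thesis using hpos by simp
  qed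
  then have zh: "Re (z * h) = s * cmod h" by simp
  define R where "R = rotation p q c z"
  define X' Y' where "X' = col_sq (M ** R) p" and "Y' = col_sq (M ** R) q"
  have X': "X' = c\<^sup>2 * X + s\<^sup>2 * Y + c * s * b" and Y': "Y' = s\<^sup>2 * X + c\<^sup>2 * Y - c * s * b"
    unfolding X'_def Y'_def R_def col_sq_rotation[OF pq h_def] zh zs
    by (simp_all add: X_def Y_def b_def)
  have "X' + Y' = (c\<^sup>2 + s\<^sup>2) * (X + Y)" by (simp add: X' Y' algebra_simps)
  then have sum: "X' + Y' = X + Y" by (simp add: cs)
  have "X' - Y' = (c\<^sup>2 + s\<^sup>2) * d + 2 * s * (c * b - s * d)"
    by (simp add: X' Y' d_def power2_eq_square algebra_simps)
  moreover have "c * b - s * d = s"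
  proof -
    have "c * b - s * d = ((d + 1) * b - b * d) / r"
      unfolding c_def s_def times_divide_eq_left by (rule diff_divide_distrib[symmetric])
    also have "(d + 1) * b - b * d = b" by (simp add: algebra_simps)
    finally show ?thesis by (simp only: s_def)
  qed
  ultimately have "X' - Y' = d + 2 * s * s" by (simp add: cs)
  then have "X' - Y' > d" using s by simp
  then have "(X' - Y')\<^sup>2 > (X - Y)\<^sup>2"
    using d unfolding d_def by (intro power_strict_mono) auto
  moreover have "(X' + Y')\<^sup>2 = (X + Y)\<^sup>2" by (simp add: sum)
  ultimately have lt: "X\<^sup>2 + Y\<^sup>2 < X'\<^sup>2 + Y'\<^sup>2"
    by (simp add: power2_eq_square algebra_simps)
  have split: "(\<Sum>j\<in>UNIV. f j) = f p + f q + (\<Sum>j\<in>UNIV - {p} - {q}. f j)" for f :: "_ \<Rightarrow> real"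
    using pq by (subst sum.remove[of _ p], simp, simp, subst sum.remove[of _ q]) auto
  have rest: "(\<Sum>j\<in>UNIV - {p} - {q}. (col_sq (M ** R) j)\<^sup>2) = (\<Sum>j\<in>UNIV - {p} - {q}. (col_sq M j)\<^sup>2)"
    unfolding R_def by (intro sum.cong refl) (simp add: col_sq_rotation(3)[OF pq refl])
  have "(\<Sum>j\<in>UNIV. (col_sq M j)\<^sup>2) < (\<Sum>j\<in>UNIV. (col_sq (M ** R) j)\<^sup>2)"
    unfolding split[of "\<lambda>j. (col_sq M j)\<^sup>2"] split[of "\<lambda>j. (col_sq (M ** R) j)\<^sup>2"] rest
    using lt by (simp add: X_def Y_def X'_def Y'_def)
  moreover have "unitary R"
    unfolding R_def by (rule unitary_rotation[OF pq]) (simp add: zs cs)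
  ultimately show ?thesis by blast
qed

text \<open>
  Instead of iterating, maximise the sum of the fourth powers of the column lengths over the
  compact unitary group: at a maximum \<open>jacobi_step\<close> is impossible, so the columns
  are orthogonal.
\<close>

lemma ex_unitary_orthogonal_columns:
  fixes A :: "complex^'v^'v"
  obtains W where "unitary W" "\<And>p q. p \<noteq> q \<Longrightarrow> (adj (A ** W) ** (A ** W)) $ p $ q = 0"
proof -
  let ?f = "\<lambda>W. \<Sum>j\<in>UNIV. (col_sq (A ** W) j)\<^sup>2"
  have "continuous_on {W. unitary W} ?f"
    unfolding continuous_on_def col_sq_def
    by (intro ballI tendsto_sum tendsto_power tendsto_norm tendsto_vec_nth tendsto_matrix_mult
        tendsto_const tendsto_ident_at)
  then obtain W where W: "unitary W" and max: "\<And>V. unitary V \<Longrightarrow> ?f V \<le> ?f W"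
    using continuous_attains_sup[OF compact_unitary, of ?f] unitary_mat_1 by blast
  have "(adj (A ** W) ** (A ** W)) $ p $ q = 0" if pq: "p \<noteq> q" for p q
  proof (rule ccontr)
    assume h: "(adj (A ** W) ** (A ** W)) $ p $ q \<noteq> 0"
    have "adj (adj (A ** W) ** (A ** W)) = adj (A ** W) ** (A ** W)"
      by (simp add: adj_mult)
    then have h': "(adj (A ** W) ** (A ** W)) $ q $ p \<noteq> 0"
      using h by (metis adj_nth complex_cnj_zero_iff)
    obtain R where R: "unitary R" "?f W < (\<Sum>j\<in>UNIV. (col_sq ((A ** W) ** R) j)\<^sup>2)"
      using jacobi_step[OF pq h] jacobi_step[OF pq[symmetric] h'] by (metis linear)
    then show False
      using max[OF unitary_mult[OF W R(1)]] by (simp add: matrix_mul_assoc)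
  qed
  then show ?thesis using that W by blast
qed

text \<open>
  Once the columns of \<open>A ** W\<close> are orthogonal, normalising them gives the unitary
  factor \<open>U\<close>. The singular values are written as exponentials because their
  logarithms \<open>t\<close> are the coordinates in which \<open>A\<close> will be sent to
  infinity.
\<close>

lemma singular_value_decomposition:
  fixes A :: "complex^'v^'v"
  assumes "det A \<noteq> 0"
  obtains U V :: "complex^'v^'v" and t :: "real^'v" where
    "unitary U" "unitary V" "A = U ** diag_mat (\<lambda>i. of_real (exp (t $ i))) ** V"
proof -
  obtain W where W: "unitary W" and
    orth: "\<And>p q. p \<noteq> q \<Longrightarrow> (adj (A ** W) ** (A ** W)) $ p $ q = 0"
    using ex_unitary_orthogonal_columns by blast
  define M where "M = A ** W"
  have diag: "adj M ** M = diag_mat (\<lambda>j. of_real (col_sq M j))"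
  proof -
    have "(adj M ** M) $ j $ j = of_real (col_sq M j)" for j
      by (simp add: matrix_matrix_mult_def col_sq_def complex_norm_square mult.commute
          del: of_real_power)
    moreover have "(adj M ** M) $ i $ j = 0" if "i \<noteq> j" for i j
      unfolding M_def by (rule orth[OF that])
    ultimately show ?thesis by (simp add: vec_eq_iff diag_mat_def)
  qed
  have "det M \<noteq> 0" using assms norm_det_unitary[OF W] by (auto simp: M_def det_mul)
  then have "(\<Prod>j\<in>UNIV. complex_of_real (col_sq M j)) \<noteq> 0"
    by (metis diag det_diag_mat det_mul det_adj complex_cnj_zero_iff mult_eq_0_iff)
  then have "col_sq M j \<noteq> 0" for j by auto
  moreover have "col_sq M j \<ge> 0" for j by (simp add: col_sq_def sum_nonneg)
  ultimately have pos: "col_sq M j > 0" for j by (simp add: less_le)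
  define t :: "real^'v" where "t = (\<chi> j. ln (col_sq M j) / 2)"
  have t: "exp (t $ j) * exp (t $ j) = col_sq M j" for j
    by (simp add: t_def exp_add[symmetric] pos)
  define E where "E = diag_mat (\<lambda>i. of_real (exp (t $ i)))"
  define E' where "E' = diag_mat (\<lambda>i. of_real (exp (- (t $ i))))"
  have EE: "E' ** E = mat 1"
    unfolding E_def E'_def diag_mat_mult diag_mat_1[symmetric]
    by (simp add: exp_minus field_simps)
  define U where "U = M ** E'"
  have "adj U ** U = E' ** (adj M ** M) ** E'"
    by (simp add: U_def adj_mult E'_def adj_diag_mat matrix_mul_assoc)
  also have "\<dots> = mat 1"
    unfolding diag E'_def diag_mat_mult diag_mat_1[symmetric] t[symmetric]
    by (simp add: exp_minus field_simps)
  finally have "unitary U" by (simp add: unitary_def)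
  moreover have "U ** E ** adj W = A"
    by (metis EE M_def U_def W matrix_mul_assoc matrix_mul_rid unitary_right)
  ultimately show ?thesis
    using that[of U "adj W" t] unitary_adj[OF W] by (simp add: E_def)
qed

section \<open>Matrices acting on the slots of tensors\<close>

text \<open>
  A tensor of order \<open>D\<close> is given by its coordinates, a function of words of length
  \<open>D\<close> in the basis indices. Words are extensional functions, so that there are
  finitely many; values of a tensor outside \<open>words D\<close> carry no information.
\<close>

abbreviation words :: "nat \<Rightarrow> (nat \<Rightarrow> 'v) set" where
  "words D \<equiv> PiE {..<D} (\<lambda>_. UNIV)"

text \<open>
  The tensor product of the matrices \<open>M 0\<close>, ..., \<open>M (D - 1)\<close>. Allowing
  different matrices in the slots covers both the group action, with the same matrix everywhere,
  and the action of the Lie algebra, whose summands have one matrix in slot \<open>i\<close> and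
  the identity elsewhere (\<open>slot\<close> below). Both then obey the same rules for
  composition and adjoints.
\<close>

definition slotwise :: "nat \<Rightarrow> (nat \<Rightarrow> complex^'v^'v) \<Rightarrow>
    ((nat \<Rightarrow> 'v) \<Rightarrow> complex) \<Rightarrow> (nat \<Rightarrow> 'v) \<Rightarrow> complex" where
  "slotwise D M T k = (\<Sum>l\<in>words D. (\<Prod>i<D. M i $ k i $ l i) * T l)"

abbreviation tensor_act :: "nat \<Rightarrow> complex^'v^'v \<Rightarrow>
    ((nat \<Rightarrow> 'v) \<Rightarrow> complex) \<Rightarrow> (nat \<Rightarrow> 'v) \<Rightarrow> complex" where
  "tensor_act D A \<equiv> slotwise D (\<lambda>_. A)"

definition tensor_inner :: "nat \<Rightarrow> ((nat \<Rightarrow> 'v) \<Rightarrow> complex) \<Rightarrow>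
    ((nat \<Rightarrow> 'v) \<Rightarrow> complex) \<Rightarrow> complex" where
  "tensor_inner D S T = (\<Sum>k\<in>words D. S k * cnj (T k))"

definition slot :: "nat \<Rightarrow> complex^'v^'v \<Rightarrow> nat \<Rightarrow> complex^'v^'v" where
  "slot i P = (\<lambda>j. if j = i then P else mat 1)"

lemma finite_words [simp]: "finite (words D :: (nat \<Rightarrow> 'v::finite) set)"
  by (simp add: finite_PiE)

lemma fun_upd_words: "k \<in> words D \<Longrightarrow> i < D \<Longrightarrow> k(i := b) \<in> words D"
  by (auto simp: PiE_iff extensional_def)

lemma words_neqE:
  assumes "k \<in> words D" "l \<in> words D" "l \<noteq> k"
  obtains i where "i < D" "l i \<noteq> k i"
  using PiE_ext[OF assms(2,1)] assms(3) by (metis lessThan_iff)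

lemma slotwise_cong:
  assumes "\<And>i. i < D \<Longrightarrow> M i = N i" "\<And>l. l \<in> words D \<Longrightarrow> S l = T l"
  shows "slotwise D M S k = slotwise D N T k"
  unfolding slotwise_def using assms by (intro sum.cong arg_cong2[of _ _ _ _ "(*)"] prod.cong) auto

lemma slotwise_compose:
  fixes M N :: "nat \<Rightarrow> complex^'v::finite^'v"
  shows "slotwise D M (slotwise D N T) k = slotwise D (\<lambda>i. M i ** N i) T k"
proof -
  have "slotwise D M (slotwise D N T) k =
      (\<Sum>l\<in>words D. \<Sum>m\<in>words D. (\<Prod>i<D. M i $ k i $ l i) * ((\<Prod>i<D. N i $ l i $ m i) * T m))"
    by (simp add: slotwise_def sum_distrib_left)
  also have "\<dots> = (\<Sum>m\<in>words D. \<Sum>l\<in>words D. (\<Prod>i<D. M i $ k i $ l i) * ((\<Prod>i<D. N i $ l i $ m i) * T m))"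
    by (rule sum.swap)
  also have "\<dots> = (\<Sum>m\<in>words D. (\<Sum>l\<in>words D. \<Prod>i<D. M i $ k i $ l i * N i $ l i $ m i) * T m)"
    by (simp add: prod.distrib sum_distrib_right mult.assoc)
  also have "\<dots> = slotwise D (\<lambda>i. M i ** N i) T k"
    unfolding slotwise_def matrix_matrix_mult_def
    by (intro sum.cong refl) (simp add: prod_sum_PiE)
  finally show ?thesis .
qed

lemma slotwise_diag:
  fixes k :: "nat \<Rightarrow> 'v::finite"
  assumes "k \<in> words D"
  shows "slotwise D (\<lambda>i. diag_mat (d i)) T k = (\<Prod>i<D. d i (k i)) * T k"
proof -
  have "(\<Prod>i<D. diag_mat (d i) $ k i $ l i) = 0" if l: "l \<in> words D" "l \<noteq> k" for l
  proof -
    obtain i where i: "i < D" "l i \<noteq> k i"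
      using words_neqE[OF assms l] .
    then have "diag_mat (d i) $ k i $ l i = 0" by (simp add: diag_mat_def)
    then show ?thesis using i(1) by (intro prod_zero) auto
  qed
  then have "(\<Sum>l\<in>words D - {k}. (\<Prod>i<D. diag_mat (d i) $ k i $ l i) * T l) = 0"
    by (intro sum.neutral) auto
  then show ?thesis
    unfolding slotwise_def using assms
    by (subst sum.remove[of _ k]) (auto simp: diag_mat_def)
qed

lemma slotwise_mat_1:
  fixes k :: "nat \<Rightarrow> 'v::finite"
  assumes "k \<in> words D" shows "slotwise D (\<lambda>i. mat 1) T k = T k"
  using slotwise_diag[OF assms, of "\<lambda>_ _. 1" T] by (simp add: diag_mat_1)

lemma slotwise_slot:
  fixes k :: "nat \<Rightarrow> 'v::finite"
  assumes k: "k \<in> words D" and i: "i < D"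
  shows "slotwise D (slot i P) T k = (\<Sum>b\<in>UNIV. P $ k i $ b * T (k(i := b)))"
proof -
  have 0: "(\<Prod>j<D. slot i P j $ k j $ l j) = 0" if l: "l \<in> words D" "l \<notin> range (\<lambda>b. k(i := b))" for l
  proof -
    have "l \<noteq> k(i := l i)" using l by auto
    obtain j where j: "j < D" "l j \<noteq> (k(i := l i)) j"
      using words_neqE[OF fun_upd_words[OF k i] l(1) \<open>l \<noteq> k(i := l i)\<close>] .
    then have "slot i P j $ k j $ l j = 0"
      by (auto simp: slot_def mat_def split: if_splits)
    then show ?thesis using j(1) by (intro prod_zero) auto
  qed
  have 1: "(\<Prod>j<D. slot i P j $ k j $ (k(i := b)) j) = P $ k i $ b" for b
  proof -
    have "(\<Prod>j\<in>{..<D} - {i}. slot i P j $ k j $ (k(i := b)) j) = 1"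
      by (intro prod.neutral) (auto simp: slot_def mat_def)
    then show ?thesis using i by (subst prod.remove[of _ i]) (auto simp: slot_def)
  qed
  have "slotwise D (slot i P) T k =
      (\<Sum>l\<in>range (\<lambda>b. k(i := b)). (\<Prod>j<D. slot i P j $ k j $ l j) * T l)"
    unfolding slotwise_def
    by (rule sum.mono_neutral_right) (use 0 fun_upd_words[OF k i] in auto)
  also have "\<dots> = (\<Sum>b\<in>UNIV. P $ k i $ b * T (k(i := b)))"
    by (subst sum.reindex) (auto simp: 1 inj_on_def fun_eq_iff simp del: fun_upd_apply, metis fun_upd_same)
  finally show ?thesis .
qed

lemma slotwise_adjoint:
  fixes M :: "nat \<Rightarrow> complex^'v::finite^'v"
  shows "tensor_inner D (slotwise D M S) T = tensor_inner D S (slotwise D (\<lambda>i. adj (M i)) T)"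
proof -
  have "tensor_inner D (slotwise D M S) T =
     (\<Sum>k\<in>words D. \<Sum>l\<in>words D. (\<Prod>i<D. M i $ k i $ l i) * S l * cnj (T k))"
    by (simp add: tensor_inner_def slotwise_def sum_distrib_right)
  also have "\<dots> = (\<Sum>l\<in>words D. \<Sum>k\<in>words D. (\<Prod>i<D. M i $ k i $ l i) * S l * cnj (T k))"
    by (rule sum.swap)
  also have "\<dots> = tensor_inner D S (slotwise D (\<lambda>i. adj (M i)) T)"
    by (simp add: tensor_inner_def slotwise_def sum_distrib_left mult_ac)
  finally show ?thesis .
qed

lemma tendsto_slotwise:
  fixes A :: "'a \<Rightarrow> complex^'v::finite^'v"
  assumes "(A \<longlongrightarrow> A') F" "\<And>l. l \<in> words D \<Longrightarrow> ((\<lambda>x. T x l) \<longlongrightarrow> T' l) F"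
  shows "((\<lambda>x. tensor_act D (A x) (T x) k) \<longlongrightarrow> tensor_act D A' T' k) F"
  unfolding slotwise_def
  by (intro tendsto_sum tendsto_mult tendsto_prod tendsto_vec_nth assms)

text \<open>
  The number \<open>\<Sum>i<D. tensor_inner D (slotwise D (slot i P) T) T\<close> is the
  derivative of the squared length of \<open>T\<close>, up to a factor \<open>2\<close>, in the
  direction of a Hermitian matrix \<open>P\<close>. The condition thus says that the length is
  stationary at \<open>T\<close> along its \<open>SL\<close>-orbit, that is, that the moment map
  vanishes.
\<close>

definition critical :: "nat \<Rightarrow> ((nat \<Rightarrow> 'v::finite) \<Rightarrow> complex) \<Rightarrow> bool" where
  "critical D T \<longleftrightarrow>
     (\<exists>c. \<forall>P. (\<Sum>i<D. tensor_inner D (slotwise D (slot i P) T) T) = c * trace P)"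

text \<open>
  Criticality is a condition on \<open>T\<close> in all Hermitian directions at once.
  Conjugating \<open>diag q\<close> by \<open>V\<close> gives such a direction, of trace zero,
  and turns the condition into a statement about the weights \<open>\<Sum>i<D. q (k i)\<close>
  by which the diagonal torus acts on \<open>V T\<close>: their average, weighted by the squared
  coordinates of \<open>V T\<close>, is zero.
\<close>

lemma critical_weights:
  fixes T :: "(nat \<Rightarrow> 'v::finite) \<Rightarrow> complex" and q :: "'v \<Rightarrow> real"
  assumes T: "critical D T" and V: "unitary V" and q: "(\<Sum>i\<in>UNIV. q i) = 0"
  shows "(\<Sum>k\<in>words D. (\<Sum>i<D. q (k i)) * (cmod (tensor_act D V T k))\<^sup>2) = 0"
proof -
  obtain c where c: "\<And>P. (\<Sum>i<D. tensor_inner D (slotwise D (slot i P) T) T) = c * trace P"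
    using T unfolding critical_def by auto
  define Q where "Q = diag_mat (\<lambda>i. complex_of_real (q i))"
  define VT where "VT = tensor_act D V T"
  have VV: "adj V ** V = mat 1" using V by (simp add: unitary_def)
  have "tensor_inner D (slotwise D (slot i Q) VT) VT =
      tensor_inner D (slotwise D (slot i (adj V ** Q ** V)) T) T" for i
  proof -
    have "tensor_inner D (slotwise D (slot i Q) VT) VT =
        tensor_inner D (tensor_act D (adj V) (slotwise D (slot i Q) VT)) T"
      unfolding slotwise_adjoint[of D "\<lambda>_. adj V"] by (simp add: VT_def)
    also have "tensor_act D (adj V) (slotwise D (slot i Q) VT) =
        slotwise D (\<lambda>j. adj V ** slot i Q j ** V) T"
      by (simp add: fun_eq_iff VT_def slotwise_compose matrix_mul_assoc)
    also have "(\<lambda>j. adj V ** slot i Q j ** V) = slot i (adj V ** Q ** V)"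
      by (simp add: fun_eq_iff slot_def VV)
    finally show ?thesis .
  qed
  then have "(\<Sum>i<D. tensor_inner D (slotwise D (slot i Q) VT) VT) = c * trace (adj V ** Q ** V)"
    by (simp add: c)
  also have "trace (adj V ** Q ** V) = trace Q"
    by (metis V matrix_mul_assoc matrix_mul_lid trace_mul_sym unitary_right)
  also have "trace Q = of_real (\<Sum>i\<in>UNIV. q i)"
    by (simp add: Q_def trace_def diag_mat_def)
  finally have 0: "(\<Sum>i<D. tensor_inner D (slotwise D (slot i Q) VT) VT) = 0"
    by (simp add: q)
  have "tensor_inner D (slotwise D (slot i Q) VT) VT =
      (\<Sum>k\<in>words D. of_real (q (k i) * (cmod (VT k))\<^sup>2))" if "i < D" for i
    unfolding tensor_inner_def
  proof (intro sum.cong refl)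
    fix k :: "nat \<Rightarrow> 'v" assume k: "k \<in> words D"
    have "slotwise D (slot i Q) VT k = (\<Sum>b\<in>UNIV. if b = k i then of_real (q (k i)) * VT k else 0)"
      unfolding slotwise_slot[OF k that] by (intro sum.cong) (auto simp: Q_def diag_mat_def)
    then show "slotwise D (slot i Q) VT k * cnj (VT k) = of_real (q (k i) * (cmod (VT k))\<^sup>2)"
      by (simp add: complex_norm_square mult.assoc del: of_real_power)
  qed
  then have eq: "(\<Sum>i<D. tensor_inner D (slotwise D (slot i Q) VT) VT) =
      of_real (\<Sum>i<D. \<Sum>k\<in>words D. q (k i) * (cmod (VT k))\<^sup>2)"
    by simp
  have "(\<Sum>i<D. \<Sum>k\<in>words D. q (k i) * (cmod (VT k))\<^sup>2) = 0"
    using 0 unfolding eq of_real_eq_0_iff .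
  then show ?thesis
    unfolding sum_distrib_right VT_def by (subst sum.swap)
qed

section \<open>Orbits of critical tensors\<close>

lemma tendsto_det:
  fixes A :: "'a \<Rightarrow> complex^'v^'v"
  assumes "(A \<longlongrightarrow> A') F" shows "((\<lambda>x. det (A x)) \<longlongrightarrow> det A') F"
  unfolding det_def by (intro tendsto_sum tendsto_mult tendsto_prod tendsto_const tendsto_vec_nth assms)

text \<open>
  Group elements with the same effect on \<open>T\<close> differ by the stabiliser of
  \<open>T\<close>, which may well be noncompact. Choosing the shortest representative removes
  this ambiguity.
\<close>

lemma ex_shortest_representative:
  fixes g :: "complex^'v::finite^'v"
  assumes "det g = 1"
  obtains h where "det h = 1" "\<And>k. k \<in> words D \<Longrightarrow> tensor_act D h T k = tensor_act D g T k"
    "\<And>h'. det h' = 1 \<Longrightarrow> (\<And>k. k \<in> words D \<Longrightarrow> tensor_act D h' T k = tensor_act D g T k) \<Longrightarrow>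
      norm h \<le> norm h'"
proof -
  define S where "S = {h. det h = 1} \<inter> (\<Inter>k\<in>words D. {h. tensor_act D h T k = tensor_act D g T k})"
  have "continuous_on UNIV (\<lambda>h :: complex^'v^'v. det h)"
    unfolding continuous_on_def by (intro ballI tendsto_det tendsto_ident_at)
  moreover have "continuous_on UNIV (\<lambda>h. tensor_act D h T k)" for k
    unfolding continuous_on_def by (intro ballI tendsto_slotwise tendsto_ident_at tendsto_const)
  ultimately have "closed S"
    unfolding S_def by (intro closed_Int closed_INT ballI closed_Collect_eq continuous_on_const)
  moreover have "g \<in> S" using assms by (simp add: S_def)
  ultimately obtain h where h: "h \<in> S" "\<And>h'. h' \<in> S \<Longrightarrow> dist 0 h \<le> dist 0 h'"
    using distance_attains_inf[of S 0] by blast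
  show ?thesis
    by (rule that[of h]) (use h in \<open>auto simp: S_def\<close>)
qed

lemma norm_diag_mat_mult:
  fixes X :: "complex^'v::finite^'v"
  shows "(norm (diag_mat (\<lambda>i. of_real (exp (t i))) ** X))\<^sup>2 =
    (\<Sum>i\<in>UNIV. exp (2 * t i) * (\<Sum>j\<in>UNIV. (cmod (X $ i $ j))\<^sup>2))"
proof -
  have nth: "(diag_mat (\<lambda>i. complex_of_real (exp (t i))) ** X) $ i $ j = of_real (exp (t i)) * X $ i $ j" for i j
  proof -
    have "(diag_mat (\<lambda>i. complex_of_real (exp (t i))) ** X) $ i $ j =
      (\<Sum>k\<in>UNIV. if k = i then of_real (exp (t i)) * X $ i $ j else 0)"
      unfolding matrix_matrix_mult_def diag_mat_def by (simp only: vec_lambda_beta) (intro sum.cong, auto)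
    then show ?thesis by simp
  qed
  have "(exp (t i))\<^sup>2 = exp (2 * t i)" for i
    by (simp add: exp_double)
  then show ?thesis
    by (simp add: norm_matrix_square nth norm_mult power_mult_distrib sum_distrib_left)
qed

lemma sum_nonpos_zeroD:
  fixes f :: "'a \<Rightarrow> real"
  assumes "finite I" "\<And>i. i \<in> I \<Longrightarrow> f i \<le> 0" "sum f I = 0" "i \<in> I"
  shows "f i = 0"
  using sum_nonneg_eq_0_iff[of I "\<lambda>i. - f i"] assms by (simp add: sum_negf)

text \<open>
  The exponentials with the largest exponents dominate the sum, and they belong to coordinates
  with \<open>q $ i > 0\<close>, where the weight \<open>c n i\<close> is eventually below
  \<open>1\<close>. Coordinates with \<open>q $ i \<le> 0\<close> may have large weights, but
  their exponentials are negligible against that of \<open>i0\<close>.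
\<close>

lemma eventually_weighted_sum_less:
  fixes t :: "nat \<Rightarrow> real^'v::finite" and c :: "nat \<Rightarrow> 'v \<Rightarrow> real"
  assumes tau: "filterlim \<tau> at_top sequentially"
    and t: "\<And>n i. t n $ i = \<tau> n * x n $ i" and x: "x \<longlonglongrightarrow> q"
    and c: "\<And>i. (\<lambda>n. c n i) \<longlonglongrightarrow> \<gamma> i" and less: "\<And>i. q $ i > 0 \<Longrightarrow> \<gamma> i < 1"
    and ex: "q $ i0 > 0"
  shows "\<forall>\<^sub>F n in sequentially.
    (\<Sum>i\<in>UNIV. exp (2 * t n $ i) * c n i) < (\<Sum>i\<in>UNIV. exp (2 * t n $ i))"
proof -
  \<comment> \<open>After division by \<open>exp (a * \<tau> n)\<close> the summand of
    \<open>i0\<close> still tends to minus infinity, whereas each summand with \<open>q $ i \<le>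
    0\<close> tends to zero: \<open>a\<close> lies strictly between the rates \<open>0\<close> and
    \<open>2 * a\<close>.\<close>
  define a where "a = q $ i0"
  define N where "N = real CARD('v)"
  define e where "e n i = exp (\<tau> n * (2 * x n $ i - a)) * (c n i - 1)" for n i
  have a: "a > 0" using ex by (simp add: a_def)
  have lim: "(\<lambda>n. 2 * x n $ i - a) \<longlonglongrightarrow> 2 * q $ i - a" for i
    by (intro tendsto_intros x)
  have "\<forall>\<^sub>F n in sequentially. e n i \<le> 1" for i
  proof (cases "q $ i > 0")
    case True
    then have "\<forall>\<^sub>F n in sequentially. c n i < 1"
      using order_tendstoD(2)[OF c less] by blast
    then show ?thesis
    proof eventually_elim
      case (elim n)
      then have "e n i \<le> 0" unfolding e_def by (intro mult_nonneg_nonpos) auto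
      then show ?case by simp
    qed
  next
    case False
    then have "filterlim (\<lambda>n. (2 * x n $ i - a) * \<tau> n) at_bot sequentially"
      using a by (intro filterlim_tendsto_neg_mult_at_bot[OF lim _ tau]) auto
    then have "(\<lambda>n. exp ((2 * x n $ i - a) * \<tau> n)) \<longlonglongrightarrow> 0"
      by (rule filterlim_compose[OF exp_at_bot])
    then have "(\<lambda>n. exp ((2 * x n $ i - a) * \<tau> n) * (c n i - 1)) \<longlonglongrightarrow> 0 * (\<gamma> i - 1)"
      by (intro tendsto_intros c)
    then have "(\<lambda>n. e n i) \<longlonglongrightarrow> 0" by (simp add: e_def mult.commute)
    then have "\<forall>\<^sub>F n in sequentially. e n i < 1" by (rule order_tendstoD) simp
    then show ?thesis by eventually_elim simp
  qed
  then have others: "\<forall>\<^sub>F n in sequentially. \<forall>i\<in>UNIV - {i0}. e n i \<le> 1"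
    by (intro eventually_ball_finite) auto
  have "filterlim (\<lambda>n. (2 * x n $ i0 - a) * \<tau> n) at_top sequentially"
    using a by (intro filterlim_tendsto_pos_mult_at_top[OF lim _ tau]) (simp add: a_def)
  then have "filterlim (\<lambda>n. exp ((2 * x n $ i0 - a) * \<tau> n)) at_top sequentially"
    by (rule filterlim_compose[OF exp_at_top])
  moreover have "(\<lambda>n. c n i0 - 1) \<longlonglongrightarrow> \<gamma> i0 - 1" by (intro tendsto_intros c)
  ultimately have "filterlim (\<lambda>n. (c n i0 - 1) * exp ((2 * x n $ i0 - a) * \<tau> n)) at_bot sequentially"
    using less[OF ex] by (intro filterlim_tendsto_neg_mult_at_bot) auto
  then have "filterlim (\<lambda>n. e n i0) at_bot sequentially"
    by (simp add: e_def mult.commute)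
  then have "\<forall>\<^sub>F n in sequentially. e n i0 \<le> - N"
    by (simp add: filterlim_at_bot)
  with others show ?thesis
  proof eventually_elim
    case (elim n)
    have "(\<Sum>i\<in>UNIV. e n i) = e n i0 + (\<Sum>i\<in>UNIV - {i0}. e n i)"
      by (rule sum.remove) auto
    also have "(\<Sum>i\<in>UNIV - {i0}. e n i) \<le> of_nat (card (UNIV - {i0})) * 1"
      using elim by (intro sum_bounded_above) auto
    also have "\<dots> = N - 1"
      by (simp add: N_def of_nat_diff)
    finally have "(\<Sum>i\<in>UNIV. e n i) < 0" using elim by linarith
    then have "exp (a * \<tau> n) * (\<Sum>i\<in>UNIV. e n i) < 0"
      by (simp add: mult_less_0_iff)
    also have "exp (a * \<tau> n) * (\<Sum>i\<in>UNIV. e n i) = (\<Sum>i\<in>UNIV. exp (2 * t n $ i) * (c n i - 1))"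
      unfolding sum_distrib_left
    proof (intro sum.cong refl)
      fix i
      have "exp (a * \<tau> n) * exp (\<tau> n * (2 * x n $ i - a)) = exp (2 * t n $ i)"
        by (simp add: exp_add[symmetric] t algebra_simps)
      then show "exp (a * \<tau> n) * e n i = exp (2 * t n $ i) * (c n i - 1)"
        by (simp add: e_def)
    qed
    finally show ?case by (simp add: right_diff_distrib sum_subtractf)
  qed
qed

text \<open>
  The theorem of Kempf and Ness that a critical vector has a closed orbit, for tensors. Let
  \<open>h n\<close> be the shortest matrices with \<open>h n T = g n T\<close>. If they are
  bounded, a limit point of them does what is wanted. Otherwise write \<open>h n = U n ** diag
  (exp (t n)) ** V n\<close> and pass to a subsequence along which \<open>U n\<close>, \<open>V
  n\<close> and the directions \<open>t n / norm (t n)\<close> converge, to \<open>U\<close>,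
  \<open>V\<close> and \<open>q\<close>. As \<open>h n T\<close> converges, a coordinate of
  \<open>V T\<close> of positive weight for \<open>q\<close> would blow up, so all weights that
  occur in \<open>V T\<close> are nonpositive; by \<open>critical_weights\<close> their average
  is zero, so they all vanish. Hence the one-parameter group generated by \<open>q\<close> fixes
  \<open>V T\<close>, and going back along it shortens \<open>h n\<close> for large
  \<open>n\<close> without changing \<open>h n T\<close>, contrary to the choice of \<open>h
  n\<close>.
\<close>

theorem tensor_orbit_closed:
  fixes T S :: "(nat \<Rightarrow> 'v::finite) \<Rightarrow> complex" and g :: "nat \<Rightarrow> complex^'v^'v"
  assumes crit: "critical D T" and g: "\<And>n. det (g n) = 1"
    and lim: "\<And>k. k \<in> words D \<Longrightarrow> (\<lambda>n. tensor_act D (g n) T k) \<longlonglongrightarrow> S k"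
  shows "\<exists>h. det h = 1 \<and> (\<forall>k\<in>words D. tensor_act D h T k = S k)"
proof -
  have "\<forall>n. \<exists>h. det h = 1 \<and> (\<forall>k\<in>words D. tensor_act D h T k = tensor_act D (g n) T k) \<and>
    (\<forall>h'. det h' = 1 \<longrightarrow> (\<forall>k\<in>words D. tensor_act D h' T k = tensor_act D (g n) T k) \<longrightarrow>
      norm h \<le> norm h')"
    using ex_shortest_representative[OF g] by metis
  then obtain h where h: "\<And>n. det (h n) = 1"
    and hT: "\<And>n k. k \<in> words D \<Longrightarrow> tensor_act D (h n) T k = tensor_act D (g n) T k"
    and short: "\<And>n h'. det h' = 1 \<Longrightarrow>
      (\<And>k. k \<in> words D \<Longrightarrow> tensor_act D h' T k = tensor_act D (g n) T k) \<Longrightarrow> norm (h n) \<le> norm h'"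
    by metis
  have hlim: "(\<lambda>n. tensor_act D (h n) T k) \<longlonglongrightarrow> S k" if "k \<in> words D" for k
    using lim[OF that] by (simp add: hT[OF that])
  have "bounded (range h)"
  proof (rule ccontr)
    assume unb: "\<not> bounded (range h)"
    have "\<exists>n\<ge>m. norm (h n) > real m" for m
    proof (rule ccontr)
      assume "\<not> (\<exists>n\<ge>m. norm (h n) > real m)"
      then have "h n \<in> h ` {..<m} \<union> cball 0 (real m)" for n
        by (cases "n < m") (auto simp: not_less)
      then have "range h \<subseteq> h ` {..<m} \<union> cball 0 (real m)" by blast
      moreover have "bounded (h ` {..<m} \<union> cball 0 (real m))"
        by (simp add: finite_imp_bounded)
      ultimately show False using unb bounded_subset by blast
    qed
    then obtain r0 where r0: "\<And>m. r0 m \<ge> m" "\<And>m. norm (h (r0 m)) > real m" by metis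
    have "\<forall>n. \<exists>U V t. unitary U \<and> unitary V \<and>
        h (r0 n) = U ** diag_mat (\<lambda>i. of_real (exp (t $ i))) ** V"
      using singular_value_decomposition h by (metis zero_neq_one)
    then obtain U0 V0 t0 where U0: "\<And>n. unitary (U0 n)" and V0: "\<And>n. unitary (V0 n)"
      and svd0: "\<And>n. h (r0 n) = U0 n ** diag_mat (\<lambda>i. of_real (exp (t0 n $ i))) ** V0 n"
      by metis
    define x0 where "x0 n = (1 / norm (t0 n)) *\<^sub>R t0 n" for n
    define K where "K = {U :: complex^'v^'v. unitary U} \<times> {V :: complex^'v^'v. unitary V} \<times> cball (0 :: real^'v) 1"
    have "compact K"
      unfolding K_def by (intro compact_Times compact_unitary compact_cball)
    moreover have "\<forall>n. (U0 n, V0 n, x0 n) \<in> K"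
      by (auto simp: K_def U0 V0 x0_def)
    ultimately obtain l s where s: "strict_mono s" and l: "l \<in> K"
      and conv: "((\<lambda>n. (U0 n, V0 n, x0 n)) \<circ> s) \<longlonglongrightarrow> l"
      using compact_imp_seq_compact seq_compactE by (metis (no_types, lifting))
    obtain U V q where l_eq: "l = (U, V, q)" by (metis surj_pair)
    define r where "r n = r0 (s n)" for n
    define Us Vs t x where "Us n = U0 (s n)" and "Vs n = V0 (s n)" and "t n = t0 (s n)"
      and "x n = x0 (s n)" for n
    have unitary: "unitary U" "unitary V" "\<And>n. unitary (Us n)" "\<And>n. unitary (Vs n)"
      using l U0 V0 by (auto simp: l_eq K_def Us_def Vs_def)
    have svd: "h (r n) = Us n ** diag_mat (\<lambda>i. of_real (exp (t n $ i))) ** Vs n" for n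
      by (simp add: r_def Us_def Vs_def t_def svd0)
    have U: "Us \<longlonglongrightarrow> U" and V: "Vs \<longlonglongrightarrow> V" and q: "x \<longlonglongrightarrow> q"
      using tendsto_fst[OF conv] tendsto_fst[OF tendsto_snd[OF conv]]
        tendsto_snd[OF tendsto_snd[OF conv]]
      by (simp_all add: l_eq o_def Us_def[abs_def] Vs_def[abs_def] x_def[abs_def])
    have sn: "s n \<ge> n" for n by (rule seq_suble[OF s])
    then have rn: "r n \<ge> n" for n unfolding r_def using r0(1) order_trans by blast
    then have "filterlim r at_top sequentially"
      by (intro filterlim_at_top_mono[OF filterlim_ident]) auto
    then have rlim: "(\<lambda>n. tensor_act D (h (r n)) T k) \<longlonglongrightarrow> S k" if "k \<in> words D" for k
      by (rule filterlim_compose[OF hlim[OF that]])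
    define E where "E n = diag_mat (\<lambda>i. complex_of_real (exp (t n $ i)))" for n
    have norm_h: "(norm (h (r n)))\<^sup>2 = (\<Sum>i\<in>UNIV. exp (2 * t n $ i))" for n
    proof -
      have "norm (h (r n)) = norm (E n ** mat 1)"
        by (simp add: svd E_def norm_mult_unitary norm_unitary_mult unitary)
      moreover have "(\<Sum>j\<in>UNIV. (cmod ((mat 1 :: complex^'v^'v) $ i $ j))\<^sup>2) = 1" for i
      proof -
        have "(\<Sum>j\<in>UNIV. (cmod ((mat 1 :: complex^'v^'v) $ i $ j))\<^sup>2) = (\<Sum>j\<in>UNIV. if j = i then 1 else 0)"
          by (intro sum.cong) (auto simp: mat_def)
        then show ?thesis by simp
      qed
      ultimately show ?thesis by (simp only: E_def norm_diag_mat_mult) simp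
    qed
    define \<tau> where "\<tau> n = norm (t n)" for n
    have tau: "filterlim \<tau> at_top sequentially"
      unfolding filterlim_at_top
    proof
      fix Z
      define B where "B = real CARD('v) * exp (2 * Z)"
      have "\<forall>\<^sub>F n in sequentially. max 1 B \<le> real n"
        using filterlim_real_sequentially unfolding filterlim_at_top by (rule spec)
      then show "\<forall>\<^sub>F n in sequentially. Z \<le> \<tau> n"
      proof eventually_elim
        case (elim n)
        have "B \<le> real n * 1" using elim by simp
        also have "\<dots> \<le> real n * real n" using elim by (intro mult_left_mono) auto
        also have "\<dots> \<le> norm (h (r n)) * norm (h (r n))"
          using r0(2)[of "s n"] sn[of n] by (intro mult_mono) (auto simp: r_def)
        also have "\<dots> = (\<Sum>i\<in>UNIV. exp (2 * t n $ i))"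
          using norm_h by (simp add: power2_eq_square)
        also have "\<dots> \<le> of_nat CARD('v) * exp (2 * \<tau> n)"
        proof (intro sum_bounded_above)
          fix i show "exp (2 * t n $ i) \<le> exp (2 * \<tau> n)"
            using component_le_norm_cart[of "t n" i] by (simp add: \<tau>_def)
        qed
        finally show ?case by (simp add: B_def)
      qed
    qed
    have tx: "t n $ i = \<tau> n * x n $ i" for n i
      by (cases "t n = 0") (simp_all add: \<tau>_def x_def x0_def t_def)
    have "(\<Sum>i\<in>UNIV. t n $ i) = 0" for n
    proof -
      have "cmod (det (Us n ** E n ** Vs n)) = 1"
        using h[of "r n"] by (simp add: svd E_def)
      then have "cmod (det (E n)) = 1"
        by (simp add: det_mul norm_mult norm_det_unitary unitary)
      then have "exp (\<Sum>i\<in>UNIV. t n $ i) = 1"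
        by (simp add: E_def det_diag_mat prod_norm[symmetric] exp_sum)
      then show ?thesis by simp
    qed
    then have sumx: "(\<Sum>i\<in>UNIV. x n $ i) = 0" for n
      by (simp add: x_def x0_def t_def sum_divide_distrib[symmetric])
    have "(\<lambda>n. \<Sum>i\<in>UNIV. x n $ i) \<longlonglongrightarrow> (\<Sum>i\<in>UNIV. q $ i)"
      by (intro tendsto_intros q)
    then have sumq: "(\<Sum>i\<in>UNIV. q $ i) = 0"
      by (simp add: sumx LIMSEQ_const_iff)
    have "\<forall>\<^sub>F n in sequentially. norm (x n) = 1"
      using filterlim_at_top_dense[THEN iffD1, OF tau, rule_format, of 0]
      by eventually_elim (auto simp: x_def x0_def \<tau>_def t_def)
    then have "norm q = 1"
      using tendsto_unique[OF _ tendsto_norm[OF q] tendsto_eventually] by simp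
    then have "q \<noteq> 0" by auto
    then obtain i1 where "q $ i1 \<noteq> 0" by (auto simp: vec_eq_iff)
    then obtain i0 where i0: "q $ i0 > 0"
      using sum_nonpos_zeroD[of UNIV "\<lambda>i. q $ i" i1] sumq by (meson UNIV_I finite linorder_not_le)
    define wt where "wt k = (\<Sum>i<D. q $ k i)" for k
    \<comment> \<open>\<open>wt k\<close> is the weight of the diagonal direction \<open>q\<close>
      on the coordinate \<open>k\<close>. The sequence \<open>adj (Us n) (h (r n) T)\<close>
      converges, and its coordinate \<open>k\<close> is that of \<open>Vs n T\<close> times
      \<open>exp (\<tau> n * wt k)\<close>, up to the error in the direction.\<close>
    have nonpos: "wt k \<le> 0" if k: "k \<in> words D" and nz: "tensor_act D V T k \<noteq> 0" for k
    proof (rule ccontr)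
      assume "\<not> wt k \<le> 0"
      then have pos: "wt k > 0" by simp
      have eq: "tensor_act D (adj (Us n)) (tensor_act D (h (r n)) T) k =
        of_real (exp ((\<Sum>i<D. x n $ k i) * \<tau> n)) * tensor_act D (Vs n) T k" for n
      proof -
        have "tensor_act D (adj (Us n)) (tensor_act D (h (r n)) T) k =
          tensor_act D (adj (Us n) ** Us n ** E n ** Vs n) T k"
          by (simp add: slotwise_compose svd E_def matrix_mul_assoc)
        also have "\<dots> = tensor_act D (E n) (tensor_act D (Vs n) T) k"
          using unitary(3)[of n] by (simp add: slotwise_compose unitary_def)
        also have "\<dots> = (\<Prod>i<D. of_real (exp (t n $ k i))) * tensor_act D (Vs n) T k"
          unfolding E_def by (rule slotwise_diag[OF k])
        also have "(\<Prod>i<D. complex_of_real (exp (t n $ k i))) = of_real (exp ((\<Sum>i<D. x n $ k i) * \<tau> n))"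
          by (simp only: sum_distrib_right exp_sum[OF finite_lessThan] tx mult.commute[of "\<tau> n"] of_real_prod)
        finally show ?thesis .
      qed
      have "(\<lambda>n. tensor_act D (adj (Us n)) (tensor_act D (h (r n)) T) k) \<longlonglongrightarrow> tensor_act D (adj U) S k"
        by (intro tendsto_slotwise tendsto_adj U rlim)
      then have "(\<lambda>n. cmod (of_real (exp ((\<Sum>i<D. x n $ k i) * \<tau> n)) * tensor_act D (Vs n) T k))
          \<longlonglongrightarrow> cmod (tensor_act D (adj U) S k)"
        unfolding eq by (rule tendsto_norm)
      then have lim1: "(\<lambda>n. cmod (tensor_act D (Vs n) T k) * exp ((\<Sum>i<D. x n $ k i) * \<tau> n))
          \<longlonglongrightarrow> cmod (tensor_act D (adj U) S k)"
        by (simp add: norm_mult mult.commute)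
      have "(\<lambda>n. \<Sum>i<D. x n $ k i) \<longlonglongrightarrow> wt k"
        unfolding wt_def by (intro tendsto_intros q)
      then have "filterlim (\<lambda>n. (\<Sum>i<D. x n $ k i) * \<tau> n) at_top sequentially"
        by (rule filterlim_tendsto_pos_mult_at_top[OF _ pos tau])
      then have "filterlim (\<lambda>n. exp ((\<Sum>i<D. x n $ k i) * \<tau> n)) at_top sequentially"
        by (rule filterlim_compose[OF exp_at_top])
      moreover have "(\<lambda>n. cmod (tensor_act D (Vs n) T k)) \<longlonglongrightarrow> cmod (tensor_act D V T k)"
        by (intro tendsto_norm tendsto_slotwise V tendsto_const)
      ultimately have "filterlim (\<lambda>n. cmod (tensor_act D (Vs n) T k) * exp ((\<Sum>i<D. x n $ k i) * \<tau> n)) at_top sequentially"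
        using nz by (intro filterlim_tendsto_pos_mult_at_top[where c = "cmod (tensor_act D V T k)"]) auto
      then have "filterlim (\<lambda>n. cmod (tensor_act D (Vs n) T k) * exp ((\<Sum>i<D. x n $ k i) * \<tau> n)) at_infinity sequentially"
        by (rule filterlim_at_top_imp_at_infinity)
      then show False
        using lim1 not_tendsto_and_filterlim_at_infinity[OF sequentially_bot] by blast
    qed
    have wt0: "wt k = 0 \<or> tensor_act D V T k = 0" if "k \<in> words D" for k
    proof -
      have le: "wt k * (cmod (tensor_act D V T k))\<^sup>2 \<le> 0" if "k \<in> words D" for k
        using nonpos[OF that] by (cases "tensor_act D V T k = 0") (auto intro: mult_nonpos_nonneg)
      have sum0: "(\<Sum>k\<in>words D. wt k * (cmod (tensor_act D V T k))\<^sup>2) = 0"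
        unfolding wt_def by (rule critical_weights[OF crit unitary(2) sumq])
      have "wt k * (cmod (tensor_act D V T k))\<^sup>2 = 0"
        by (rule sum_nonpos_zeroD[OF finite_words le sum0 that])
      then show ?thesis by simp
    qed
    \<comment> \<open>\<open>z\<close> is the step back along the limit direction; it fixes
      \<open>T\<close> because all weights vanish.\<close>
    define Q where "Q = diag_mat (\<lambda>i. complex_of_real (exp (- (q $ i))))"
    define z where "z = adj V ** Q ** V"
    have VV: "adj V ** V = mat 1" using unitary(2) by (simp add: unitary_def)
    have zT: "tensor_act D z T k = T k" if k: "k \<in> words D" for k
    proof -
      have QV: "tensor_act D Q (tensor_act D V T) l = tensor_act D V T l" if "l \<in> words D" for l
      proof -
        have "tensor_act D Q (tensor_act D V T) l =
          (\<Prod>i<D. complex_of_real (exp (- (q $ l i)))) * tensor_act D V T l"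
          unfolding Q_def by (rule slotwise_diag[OF that])
        also have "(\<Prod>i<D. complex_of_real (exp (- (q $ l i)))) = of_real (exp (- wt l))"
          by (simp only: wt_def sum_negf[symmetric] exp_sum[OF finite_lessThan] of_real_prod)
        finally show ?thesis using wt0[OF that] by auto
      qed
      have "tensor_act D z T k = tensor_act D (adj V) (tensor_act D Q (tensor_act D V T)) k"
        by (simp add: z_def slotwise_compose matrix_mul_assoc)
      also have "\<dots> = tensor_act D (adj V) (tensor_act D V T) k"
        by (rule slotwise_cong) (simp_all add: QV)
      also have "\<dots> = T k"
        by (simp add: slotwise_compose VV slotwise_mat_1[OF k])
      finally show ?thesis .
    qed
    have "det (adj V) * det V = 1"
      unfolding det_mul[symmetric] VV by (rule det_I)
    moreover have "det Q = 1"
    proof -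
      have "det Q = of_real (exp (\<Sum>i\<in>UNIV. - (q $ i)))"
        by (simp only: Q_def det_diag_mat exp_sum[OF finite] of_real_prod)
      then show ?thesis by (simp only: sum_negf sumq) simp
    qed
    ultimately have detz: "det z = 1" by (simp add: z_def det_mul)
    have le: "norm (h (r n)) \<le> norm (h (r n) ** z)" for n
    proof (rule short)
      show "det (h (r n) ** z) = 1" by (simp add: det_mul h detz)
      fix k :: "nat \<Rightarrow> 'v" assume k: "k \<in> words D"
      have "tensor_act D (h (r n) ** z) T k = tensor_act D (h (r n)) (tensor_act D z T) k"
        by (simp add: slotwise_compose)
      also have "\<dots> = tensor_act D (h (r n)) T k"
        by (rule slotwise_cong) (simp_all add: zT)
      finally show "tensor_act D (h (r n) ** z) T k = tensor_act D (g (r n)) T k"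
        by (simp add: hT[OF k])
    qed
    \<comment> \<open>Since \<open>Vs n ** adj V\<close> tends to the identity, \<open>c n
      i\<close> tends to \<open>exp (- 2 * q $ i)\<close>.\<close>
    define c where "c n i = (\<Sum>j\<in>UNIV. (cmod ((Vs n ** adj V ** Q) $ i $ j))\<^sup>2)" for n i
    have hz: "(norm (h (r n) ** z))\<^sup>2 = (\<Sum>i\<in>UNIV. exp (2 * t n $ i) * c n i)" for n
    proof -
      have "h (r n) ** z = Us n ** (E n ** (Vs n ** adj V ** Q)) ** V"
        by (simp add: svd E_def z_def matrix_mul_assoc)
      then have "norm (h (r n) ** z) = norm (E n ** (Vs n ** adj V ** Q))"
        by (simp add: norm_mult_unitary norm_unitary_mult unitary)
      then show ?thesis by (simp add: E_def c_def norm_diag_mat_mult)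
    qed
    have "(\<lambda>n. c n i) \<longlonglongrightarrow> exp (- 2 * q $ i)" for i
    proof -
      have "(\<lambda>n. c n i) \<longlonglongrightarrow> (\<Sum>j\<in>UNIV. (cmod ((V ** adj V ** Q) $ i $ j))\<^sup>2)"
        unfolding c_def
        by (intro tendsto_sum tendsto_power tendsto_norm tendsto_vec_nth tendsto_matrix_mult V tendsto_const)
      also have "V ** adj V ** Q = Q" by (simp add: unitary_right unitary)
      also have "(\<Sum>j\<in>UNIV. (cmod (Q $ i $ j))\<^sup>2) = (\<Sum>j\<in>UNIV. if j = i then exp (- 2 * q $ i) else 0)"
        by (intro sum.cong) (auto simp: Q_def diag_mat_def exp_double[symmetric])
      finally show ?thesis by simp
    qed
    then have "\<forall>\<^sub>F n in sequentially.
        (\<Sum>i\<in>UNIV. exp (2 * t n $ i) * c n i) < (\<Sum>i\<in>UNIV. exp (2 * t n $ i))"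
      by (rule eventually_weighted_sum_less[OF tau tx q _ _ i0]) auto
    then have "\<forall>\<^sub>F n in sequentially. (norm (h (r n) ** z))\<^sup>2 < (norm (h (r n)))\<^sup>2"
      by (simp only: hz norm_h)
    then obtain n where "(norm (h (r n) ** z))\<^sup>2 < (norm (h (r n)))\<^sup>2"
      using eventually_happens'[OF sequentially_bot] by blast
    then have "norm (h (r n) ** z) < norm (h (r n))"
      by (rule power_less_imp_less_base) simp
    then show False using le[of n] by simp
  qed
  then obtain h' s where s: "strict_mono s" and h': "(h \<circ> s) \<longlonglongrightarrow> h'"
    using bounded_imp_convergent_subsequence by blast
  have "(\<lambda>n. det ((h \<circ> s) n)) \<longlonglongrightarrow> det h'"
    by (rule tendsto_det[OF h'])
  then have "det h' = 1" by (simp add: h LIMSEQ_const_iff)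
  moreover have "tensor_act D h' T k = S k" if k: "k \<in> words D" for k
  proof -
    have "(\<lambda>n. tensor_act D ((h \<circ> s) n) T k) \<longlonglongrightarrow> tensor_act D h' T k"
      by (intro tendsto_slotwise h' tendsto_const)
    moreover have "(\<lambda>n. tensor_act D ((h \<circ> s) n) T k) \<longlonglongrightarrow> S k"
      using LIMSEQ_subseq_LIMSEQ[OF hlim[OF k] s] by (simp add: o_def)
    ultimately show ?thesis by (rule LIMSEQ_unique)
  qed
  ultimately show ?thesis by blast
qed

section \<open>Forms as symmetric tensors\<close>

text \<open>
  The exponent vector of the monomial \<open>\<Prod>i\<in>I. Var (f i)\<close>.
\<close>

definition exponent :: "'i set \<Rightarrow> ('i \<Rightarrow> 'v) \<Rightarrow> 'v \<Rightarrow>\<^sub>0 nat" where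
  "exponent I f = (\<Sum>i\<in>I. Poly_Mapping.single (f i) 1)"

lemma lookup_exponent:
  assumes "finite I"
  shows "Poly_Mapping.lookup (exponent I f) v = card {i\<in>I. f i = v}"
proof -
  have "Poly_Mapping.lookup (exponent I f) v = (\<Sum>i\<in>I. if f i = v then 1 else 0)"
    unfolding exponent_def lookup_sum by (intro sum.cong) (auto simp: lookup_single)
  also have "\<dots> = card {i\<in>I. f i = v}"
    using assms by (simp add: sum.If_cases Int_def)
  finally show ?thesis .
qed

lemma degree_exponent:
  fixes f :: "'i \<Rightarrow> 'v::finite"
  assumes "finite I" shows "(\<Sum>v\<in>UNIV. Poly_Mapping.lookup (exponent I f) v) = card I"
proof -
  have "(\<Sum>v\<in>UNIV. Poly_Mapping.lookup (exponent I f) v) =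
      (\<Sum>i\<in>I. \<Sum>v\<in>UNIV. Poly_Mapping.lookup (Poly_Mapping.single (f i) 1) v)"
    unfolding exponent_def lookup_sum by (rule sum.swap)
  also have "\<dots> = (\<Sum>i\<in>I. 1)"
    by (intro sum.cong) (simp_all add: lookup_single when_def)
  finally show ?thesis by simp
qed

lemma exponent_cong: "(\<And>i. i \<in> I \<Longrightarrow> f i = g i) \<Longrightarrow> exponent I f = exponent I g"
  unfolding exponent_def by (rule sum.cong) auto

lemma prod_Var: "(\<Prod>i\<in>I. Var (f i)) = Poly_Mapping.single (exponent I f) 1"
  unfolding exponent_def
  by (induction I rule: infinite_finite_induct) (auto simp: Var_def mult_single)

lemma prod_power_exponent:
  fixes f :: "'i \<Rightarrow> 'v::finite" and \<sigma> :: "'v \<Rightarrow> 'a::comm_monoid_mult"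
  assumes "finite I"
  shows "(\<Prod>v\<in>UNIV. \<sigma> v ^ Poly_Mapping.lookup (exponent I f) v) = (\<Prod>i\<in>I. \<sigma> (f i))"
proof -
  have "(\<Prod>i\<in>I. \<sigma> (f i)) = (\<Prod>v\<in>UNIV. \<Prod>i\<in>{i\<in>I. f i = v}. \<sigma> (f i))"
    using assms by (intro prod.group[symmetric]) auto
  also have "\<dots> = (\<Prod>v\<in>UNIV. \<sigma> v ^ Poly_Mapping.lookup (exponent I f) v)"
    by (intro prod.cong refl) (simp add: lookup_exponent[OF assms])
  finally show ?thesis by simp
qed

lemma map_key_exponent:
  assumes "finite I" "inj \<sigma>"
  shows "Poly_Mapping.map_key \<sigma> (exponent I (\<lambda>i. \<sigma> (f i))) = exponent I f"
  by (rule poly_mapping_eqI)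
    (simp add: map_key.rep_eq assms lookup_exponent inj_eq[OF assms(2)])

abbreviation word_exponent :: "nat \<Rightarrow> (nat \<Rightarrow> 'v) \<Rightarrow> 'v \<Rightarrow>\<^sub>0 nat" where
  "word_exponent D \<equiv> exponent {..<D}"

lemma ex_word_exponent:
  fixes e :: "'v::finite \<Rightarrow>\<^sub>0 nat"
  assumes "(\<Sum>v\<in>UNIV. Poly_Mapping.lookup e v) = D"
  shows "\<exists>k\<in>words D. word_exponent D k = e"
  using assms
proof (induction D arbitrary: e)
  case 0
  then have "e = 0" by (intro poly_mapping_eqI) simp
  then show ?case by (simp add: exponent_def)
next
  case (Suc D)
  then obtain v where v: "Poly_Mapping.lookup e v \<noteq> 0"
    by (metis Zero_not_Suc sum.neutral)
  define e' where "e' = e - Poly_Mapping.single v 1"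
  have e: "e = e' + Poly_Mapping.single v 1"
    using v by (intro poly_mapping_eqI) (auto simp: e'_def lookup_add lookup_minus lookup_single when_def)
  have "(\<Sum>x\<in>UNIV. Poly_Mapping.lookup e' x) = D"
    using Suc.prems by (simp add: e lookup_add sum.distrib lookup_single when_def)
  then obtain k where k: "k \<in> words D" "word_exponent D k = e'"
    using Suc.IH by blast
  have "k(D := v) \<in> words (Suc D)"
    using k(1) by (auto simp: PiE_iff extensional_def)
  moreover have "word_exponent (Suc D) (k(D := v)) = e"
  proof -
    have "word_exponent D (k(D := v)) = word_exponent D k"
      by (rule exponent_cong) simp
    then show ?thesis by (simp add: exponent_def e k(2)[symmetric])
  qed
  ultimately show ?case by blast
qed

lemma Const_mult_single: "Const c * Poly_Mapping.single e d = Poly_Mapping.single e (c * d)"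
  by (simp add: Const_def mult_single)

lemma single_sum: "Poly_Mapping.single e (\<Sum>i\<in>I. f i) = (\<Sum>i\<in>I. Poly_Mapping.single e (f i))"
  by (induction I rule: infinite_finite_induct) (auto simp: single_add)

lemma Const_add: "Const (a + b) = Const a + Const b"
  by (simp add: Const_def single_add)

lemma subst_poly_superset:
  assumes "finite S" "Poly_Mapping.keys p \<subseteq> S"
  shows "subst_poly \<sigma> p =
    (\<Sum>e\<in>S. Const (Poly_Mapping.lookup p e) * (\<Prod>i\<in>UNIV. \<sigma> i ^ Poly_Mapping.lookup e i))"
  unfolding subst_poly_def using assms
  by (intro sum.mono_neutral_left) (auto simp: in_keys_iff Const_def)

lemma subst_poly_add: "subst_poly \<sigma> (p + q) = subst_poly \<sigma> p + subst_poly \<sigma> q"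
proof -
  let ?S = "Poly_Mapping.keys p \<union> Poly_Mapping.keys q"
  have fin: "finite ?S" by simp
  show ?thesis
    unfolding subst_poly_superset[OF fin keys_add] subst_poly_superset[OF fin Un_upper1]
      subst_poly_superset[OF fin Un_upper2]
    by (simp add: lookup_add Const_add ring_distribs sum.distrib)
qed

lemma subst_poly_single:
  "subst_poly \<sigma> (Poly_Mapping.single e c) = Const c * (\<Prod>i\<in>UNIV. \<sigma> i ^ Poly_Mapping.lookup e i)"
  by (subst subst_poly_superset[of "{e}"]) auto

lemma subst_poly_sum: "subst_poly \<sigma> (\<Sum>i\<in>I. p i) = (\<Sum>i\<in>I. subst_poly \<sigma> (p i))"
proof (induction I rule: infinite_finite_induct)
  case (insert x F)
  then show ?case by (simp add: subst_poly_add)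
qed (simp_all add: subst_poly_def)

text \<open>
  The quotient map from tensors to forms; \<open>tensor_of_form\<close> is its section with
  symmetric values: the coefficient of a monomial is shared equally by the words that spell it.
\<close>

definition form_of_tensor :: "nat \<Rightarrow> ((nat \<Rightarrow> 'v) \<Rightarrow> complex) \<Rightarrow> 'v cpoly" where
  "form_of_tensor D T = (\<Sum>k\<in>words D. Poly_Mapping.single (word_exponent D k) (T k))"

definition tensor_of_form :: "nat \<Rightarrow> 'v cpoly \<Rightarrow> (nat \<Rightarrow> 'v) \<Rightarrow> complex" where
  "tensor_of_form D p k = Poly_Mapping.lookup p (word_exponent D k) /
     of_nat (card {l \<in> words D. word_exponent D l = word_exponent D k})"

text \<open>
  Expanding a product of \<open>D\<close> linear forms amounts to summing over words.
\<close>

lemma act_form_of_tensor: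
  fixes A :: "complex^'v::finite^'v"
  shows "act A (form_of_tensor D T) = form_of_tensor D (tensor_act D A T)"
proof -
  have 1: "(\<Prod>i<D. \<Sum>m\<in>UNIV. Const (A $ m $ l i) * Var m) =
      (\<Sum>k\<in>words D. Poly_Mapping.single (word_exponent D k) (\<Prod>i<D. A $ k i $ l i))" for l
  proof -
    have C: "(\<Prod>i<D. Const (f i) :: 'v cpoly) = Const (\<Prod>i<D. f i)" for f
      by (induction D) (auto simp: Const_def mult_single)
    have "(\<Prod>i<D. \<Sum>m\<in>UNIV. Const (A $ m $ l i) * Var m) =
      (\<Sum>k\<in>words D. \<Prod>i<D. Const (A $ k i $ l i) * Var (k i))"
      by (rule prod_sum_PiE) auto
    also have "\<dots> = (\<Sum>k\<in>words D. Poly_Mapping.single (word_exponent D k) (\<Prod>i<D. A $ k i $ l i))"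
      by (simp add: prod.distrib prod_Var C Const_mult_single)
    finally show ?thesis .
  qed
  have "act A (form_of_tensor D T) =
     (\<Sum>l\<in>words D. Const (T l) * (\<Sum>k\<in>words D. Poly_Mapping.single (word_exponent D k) (\<Prod>i<D. A $ k i $ l i)))"
    unfolding act_def form_of_tensor_def subst_poly_sum subst_poly_single
    by (simp only: prod_power_exponent[OF finite_lessThan] 1)
  also have "\<dots> = (\<Sum>k\<in>words D. \<Sum>l\<in>words D.
      Poly_Mapping.single (word_exponent D k) ((\<Prod>i<D. A $ k i $ l i) * T l))"
    unfolding sum_distrib_left Const_mult_single mult.commute[of "T _"] by (rule sum.swap)
  also have "\<dots> = form_of_tensor D (tensor_act D A T)"
    by (simp add: form_of_tensor_def slotwise_def single_sum)
  finally show ?thesis .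
qed

lemma lookup_form_of_tensor:
  fixes T :: "(nat \<Rightarrow> 'v::finite) \<Rightarrow> complex"
  shows "Poly_Mapping.lookup (form_of_tensor D T) e = (\<Sum>k\<in>{k\<in>words D. word_exponent D k = e}. T k)"
proof -
  have "Poly_Mapping.lookup (form_of_tensor D T) e =
      (\<Sum>k\<in>words D. if word_exponent D k = e then T k else 0)"
    unfolding form_of_tensor_def lookup_sum by (intro sum.cong) (auto simp: lookup_single)
  then show ?thesis by (simp only: sum.inter_filter[OF finite_words])
qed

lemma form_of_tensor_in_Sym:
  fixes T :: "(nat \<Rightarrow> 'v::finite) \<Rightarrow> complex"
  shows "form_of_tensor D T \<in> Sym D"
  unfolding Sym_def
proof (intro CollectI ballI)
  fix e assume "e \<in> Poly_Mapping.keys (form_of_tensor D T)"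
  then have "(\<Sum>k\<in>{k\<in>words D. word_exponent D k = e}. T k) \<noteq> 0"
    unfolding in_keys_iff lookup_form_of_tensor .
  then obtain k where "k \<in> {k\<in>words D. word_exponent D k = e}"
    by (rule sum.not_neutral_contains_not_neutral)
  then have "e = word_exponent D k" by simp
  then show "(\<Sum>i\<in>UNIV. Poly_Mapping.lookup e i) = D"
    by (simp add: degree_exponent)
qed

lemma form_of_tensor_of_form:
  fixes p :: "'v::finite cpoly"
  assumes "p \<in> Sym D" shows "form_of_tensor D (tensor_of_form D p) = p"
proof (rule poly_mapping_eqI)
  fix e :: "'v \<Rightarrow>\<^sub>0 nat"
  let ?W = "{k \<in> words D. word_exponent D k = e}"
  show "Poly_Mapping.lookup (form_of_tensor D (tensor_of_form D p)) e = Poly_Mapping.lookup p e"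
  proof (cases "?W = {}")
    case True
    then have "(\<Sum>i\<in>UNIV. Poly_Mapping.lookup e i) \<noteq> D"
      using ex_word_exponent[of e D] by blast
    then have "Poly_Mapping.lookup p e = 0"
      using assms by (auto simp: Sym_def in_keys_iff)
    then show ?thesis unfolding lookup_form_of_tensor True by simp
  next
    case False
    have "(\<Sum>k\<in>?W. tensor_of_form D p k) = (\<Sum>k\<in>?W. Poly_Mapping.lookup p e / of_nat (card ?W))"
      by (intro sum.cong) (auto simp: tensor_of_form_def)
    also have "\<dots> = Poly_Mapping.lookup p e"
      using False by (simp add: card_eq_0_iff)
    finally show ?thesis by (simp only: lookup_form_of_tensor)
  qed
qed

definition symmetric_tensor :: "nat \<Rightarrow> ((nat \<Rightarrow> 'v) \<Rightarrow> complex) \<Rightarrow> bool" where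
  "symmetric_tensor D T \<longleftrightarrow>
     (\<forall>k\<in>words D. \<forall>l\<in>words D. word_exponent D k = word_exponent D l \<longrightarrow> T k = T l)"

lemma symmetric_tensorD:
  "symmetric_tensor D T \<Longrightarrow> k \<in> words D \<Longrightarrow> l \<in> words D \<Longrightarrow>
    word_exponent D k = word_exponent D l \<Longrightarrow> T k = T l"
  unfolding symmetric_tensor_def by blast

lemma tensor_of_form_of_tensor:
  fixes T :: "(nat \<Rightarrow> 'v::finite) \<Rightarrow> complex"
  assumes "symmetric_tensor D T" "k \<in> words D"
  shows "tensor_of_form D (form_of_tensor D T) k = T k"
proof -
  let ?W = "{l \<in> words D. word_exponent D l = word_exponent D k}"
  have "(\<Sum>l\<in>?W. T l) = (\<Sum>l\<in>?W. T k)"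
    by (intro sum.cong refl symmetric_tensorD[OF assms(1) _ assms(2)]) auto
  moreover have "k \<in> ?W" using assms by simp
  then have "card ?W \<noteq> 0" by (subst card_0_eq) auto
  ultimately show ?thesis by (simp add: tensor_of_form_def lookup_form_of_tensor)
qed

lemma symmetric_tensor_of_form: "symmetric_tensor D (tensor_of_form D p)"
  unfolding symmetric_tensor_def tensor_of_form_def by (intro ballI impI) (simp only:)

lemma word_exponent_eq_permutes:
  fixes k l :: "nat \<Rightarrow> 'v::finite"
  assumes "word_exponent D k = word_exponent D l"
  obtains p where "p permutes {..<D}" "\<And>i. i < D \<Longrightarrow> k i = l (p i)"
proof -
  have "image_mset k (mset_set {..<D}) = image_mset l (mset_set {..<D})"
  proof (rule multiset_eqI)
    fix v
    have "card {i\<in>{..<D}. k i = v} = card {i\<in>{..<D}. l i = v}"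
      using arg_cong[OF assms, of "\<lambda>e. Poly_Mapping.lookup e v"] by (simp only: lookup_exponent[OF finite_lessThan])
    then show "count (image_mset k (mset_set {..<D})) v = count (image_mset l (mset_set {..<D})) v"
      by (simp add: count_image_mset vimage_def Int_def conj_commute)
  qed
  then show ?thesis
    using image_mset_eq_implies_permutes[OF finite_lessThan] that by (metis lessThan_iff)
qed

lemma symmetric_tensor_act:
  fixes A :: "complex^'v::finite^'v"
  assumes T: "symmetric_tensor D T" shows "symmetric_tensor D (tensor_act D A T)"
  unfolding symmetric_tensor_def
proof (intro ballI impI)
  fix k l :: "nat \<Rightarrow> 'v"
  assume kl: "k \<in> words D" "l \<in> words D" "word_exponent D k = word_exponent D l"
  obtain p where p: "p permutes {..<D}" "\<And>i. i < D \<Longrightarrow> k i = l (p i)"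
    using word_exponent_eq_permutes[OF kl(3)] by blast
  have pD: "p i < D \<longleftrightarrow> i < D" for i using permutes_in_image[OF p(1), of i] by simp
  have bij: "bij_betw (\<lambda>m. m \<circ> p) (words D) (words D :: (nat \<Rightarrow> 'v) set)"
  proof (rule bij_betwI[where g = "\<lambda>m. m \<circ> inv p"])
    have pD': "inv p i < D \<longleftrightarrow> i < D" for i
      using permutes_in_image[OF permutes_inv[OF p(1)], of i] by simp
    show "(\<lambda>m. m \<circ> p) \<in> words D \<rightarrow> words D" "(\<lambda>m. m \<circ> inv p) \<in> words D \<rightarrow> words D"
      by (auto simp: PiE_iff extensional_def pD pD')
  qed (auto simp: fun_eq_iff permutes_inverses[OF p(1)])
  have "tensor_act D A T l = (\<Sum>m\<in>words D. (\<Prod>i<D. A $ l i $ m i) * T m)"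
    by (simp add: slotwise_def)
  also have "\<dots> = (\<Sum>m\<in>words D. (\<Prod>i<D. A $ k i $ (m \<circ> p) i) * T (m \<circ> p))"
  proof (intro sum.cong refl arg_cong2[of _ _ _ _ "(*)"])
    fix m :: "nat \<Rightarrow> 'v" assume m: "m \<in> words D"
    have "(\<Prod>i<D. A $ l i $ m i) = (\<Prod>i<D. A $ l (p i) $ m (p i))"
      using prod.permute[OF p(1), of "\<lambda>i. A $ l i $ m i"] by (simp add: o_def)
    also have "\<dots> = (\<Prod>i<D. A $ k i $ (m \<circ> p) i)"
      by (intro prod.cong) (auto simp: p(2))
    finally show "(\<Prod>i<D. A $ l i $ m i) = (\<Prod>i<D. A $ k i $ (m \<circ> p) i)" .
    have "word_exponent D m = word_exponent D (m \<circ> p)"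
      unfolding exponent_def using sum.permute[OF p(1), of "\<lambda>i. Poly_Mapping.single (m i) 1"]
      by (simp only: o_def)
    moreover have "m \<circ> p \<in> words D" using bij_betwE[OF bij] m by blast
    ultimately show "T m = T (m \<circ> p)" by (intro symmetric_tensorD[OF T m])
  qed
  also have "\<dots> = (\<Sum>m\<in>words D. (\<Prod>i<D. A $ k i $ m i) * T m)"
    by (rule sum.reindex_bij_betw[OF bij])
  finally show "tensor_act D A T k = tensor_act D A T l"
    by (simp add: slotwise_def)
qed

lemma act_in_Sym: "w \<in> Sym D \<Longrightarrow> act A w \<in> Sym D"
  by (metis act_form_of_tensor form_of_tensor_in_Sym form_of_tensor_of_form)

text \<open>
  The quotient map is equivariant and the action preserves symmetry, on which the section is
  inverse to the quotient map; so the section is equivariant as well.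
\<close>

lemma tensor_of_form_act:
  fixes A :: "complex^'v::finite^'v"
  assumes "w \<in> Sym D" "k \<in> words D"
  shows "tensor_of_form D (act A w) k = tensor_act D A (tensor_of_form D w) k"
proof -
  have "act A w = form_of_tensor D (tensor_act D A (tensor_of_form D w))"
    by (metis act_form_of_tensor form_of_tensor_of_form assms(1))
  then show ?thesis
    using tensor_of_form_of_tensor[OF symmetric_tensor_act[OF symmetric_tensor_of_form] assms(2)]
    by simp
qed

text \<open>
  The coefficients of degree \<open>D\<close> are finitely many, so a form in the closure of the
  orbit is the limit of a sequence in it. The equivariant section carries that sequence to
  tensors, and \<open>tensor_orbit_closed\<close> applies.
\<close>

theorem polystable_if_critical:
  fixes w :: "'v::finite cpoly"
  assumes w: "w \<in> Sym D" and crit: "critical D (tensor_of_form D w)"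
  shows "polystable D w"
proof -
  let ?X = "Poly_Mapping.lookup ` SL_orbit w"
  have "p \<in> SL_orbit w" if p: "p \<in> Sym D" "Poly_Mapping.lookup p \<in> closure ?X" for p
  proof -
    have "\<exists>g. det g = 1 \<and> (\<forall>k\<in>words D. dist (Poly_Mapping.lookup (act g w) (word_exponent D k))
        (Poly_Mapping.lookup p (word_exponent D k)) < inverse (real (Suc n)))" for n
    proof -
      \<comment> \<open>Only the finitely many coordinates that are exponents of words are
        constrained, which makes \<open>U\<close> open in the product topology.\<close>
      define U where "U = (\<Inter>k\<in>words D. {\<phi> :: ('v \<Rightarrow>\<^sub>0 nat) \<Rightarrow> complex.
        dist (\<phi> (word_exponent D k)) (Poly_Mapping.lookup p (word_exponent D k)) < inverse (real (Suc n))})"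
      have "open U"
        unfolding U_def
        by (intro open_INT ballI open_Collect_less continuous_intros finite_words
            continuous_on_product_coordinates)
      moreover have "Poly_Mapping.lookup p \<in> U" by (simp add: U_def)
      ultimately have "U \<inter> ?X \<noteq> {}"
        using p(2) open_Int_closure_eq_empty[of U ?X] by blast
      then show ?thesis by (auto simp: U_def SL_orbit_def SL_def)
    qed
    then obtain g where g: "\<And>n. det (g n) = 1" and
      d: "\<And>n k. k \<in> words D \<Longrightarrow> dist (Poly_Mapping.lookup (act (g n) w) (word_exponent D k))
        (Poly_Mapping.lookup p (word_exponent D k)) < inverse (real (Suc n))"
      by metis
    have conv: "(\<lambda>n. tensor_act D (g n) (tensor_of_form D w) k) \<longlonglongrightarrow> tensor_of_form D p k"
      if k: "k \<in> words D" for k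
    proof -
      have "(\<lambda>n. dist (Poly_Mapping.lookup (act (g n) w) (word_exponent D k))
        (Poly_Mapping.lookup p (word_exponent D k))) \<longlonglongrightarrow> 0"
        by (rule real_tendsto_sandwich[OF _ _ tendsto_const LIMSEQ_inverse_real_of_nat])
          (intro always_eventually allI zero_le_dist less_imp_le[OF d[OF k]])+
      then have "(\<lambda>n. Poly_Mapping.lookup (act (g n) w) (word_exponent D k)) \<longlonglongrightarrow>
          Poly_Mapping.lookup p (word_exponent D k)"
        by (subst tendsto_dist_iff)
      then show ?thesis
        unfolding tensor_of_form_act[OF w k, symmetric] tensor_of_form_def divide_inverse
        by (intro tendsto_mult tendsto_const)
    qed
    obtain h where h: "det h = 1"
      "\<And>k. k \<in> words D \<Longrightarrow> tensor_act D h (tensor_of_form D w) k = tensor_of_form D p k"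
      using tensor_orbit_closed[OF crit g conv] by blast
    have "p = form_of_tensor D (tensor_of_form D p)"
      by (rule form_of_tensor_of_form[OF p(1), symmetric])
    also have "\<dots> = form_of_tensor D (tensor_act D h (tensor_of_form D w))"
      by (simp add: form_of_tensor_def h(2))
    also have "\<dots> = act h w"
      by (simp only: act_form_of_tensor[symmetric] form_of_tensor_of_form[OF w])
    finally show ?thesis using h(1) by (auto simp: SL_orbit_def SL_def)
  qed
  moreover have "SL_orbit w \<subseteq> Sym D"
    using act_in_Sym[OF w] by (auto simp: SL_orbit_def)
  ultimately have "Sym D - SL_orbit w = Poly_Mapping.lookup -` (- closure ?X) \<inter> Sym D"
    using closure_subset[of ?X] by blast
  then have "openin (Sym_topology D) (Sym D - SL_orbit w)"
    unfolding Sym_topology_def openin_pullback_topology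
    by (intro exI[of _ "- closure ?X"]) auto
  moreover have "topspace (Sym_topology D :: 'v cpoly topology) = Sym D"
    by (simp add: Sym_topology_def topspace_pullback_topology)
  ultimately show ?thesis
    using w \<open>SL_orbit w \<subseteq> Sym D\<close> by (simp add: polystable_def closedin_def)
qed

section \<open>A criterion on monomials\<close>

lemma word_exponent_fun_upd:
  assumes "i < D"
  shows "word_exponent D (k(i := b)) =
    exponent ({..<D} - {i}) k + Poly_Mapping.single b 1"
proof -
  have "word_exponent D (k(i := b)) =
      Poly_Mapping.single b 1 + exponent ({..<D} - {i}) (k(i := b))"
    unfolding exponent_def using assms by (subst sum.remove[of _ i]) auto
  also have "exponent ({..<D} - {i}) (k(i := b)) = exponent ({..<D} - {i}) k"
    by (rule exponent_cong) auto
  finally show ?thesis by (simp only: add.commute)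
qed

text \<open>
  The off-diagonal matrix entry \<open>(a, b)\<close> of the moment map pairs the monomials of
  \<open>w\<close> with those in which one factor \<open>a\<close> has been replaced by
  \<open>b\<close>; the first hypothesis says that no two monomials of \<open>w\<close> are
  related in this way, so these entries vanish. The diagonal entry \<open>m a\<close> counts the
  factors \<open>a\<close> in all words, weighted by the squared coordinates, and the second
  hypothesis, a transitive symmetry of the absolute values of the coefficients, makes it
  independent of \<open>a\<close>.
\<close>

lemma critical_tensor_of_form:
  fixes w :: "'v::finite cpoly"
  assumes isolated: "\<And>e a b. Poly_Mapping.lookup w (e + Poly_Mapping.single a 1) \<noteq> 0 \<Longrightarrow>
      Poly_Mapping.lookup w (e + Poly_Mapping.single b 1) \<noteq> 0 \<Longrightarrow> a = b"
    and transitive: "\<And>a b. \<exists>\<sigma>. bij \<sigma> \<and> \<sigma> a = b \<and>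
      (\<forall>e. cmod (Poly_Mapping.lookup w (Poly_Mapping.map_key \<sigma> e)) = cmod (Poly_Mapping.lookup w e))"
  shows "critical D (tensor_of_form D w)"
proof -
  define T where "T = tensor_of_form D w"
  define m where "m a = (\<Sum>k\<in>words D. of_nat (card {i\<in>{..<D}. k i = a}) * (cmod (T k))\<^sup>2)" for a
  have off: "T (k(i := b)) = 0" if "T k \<noteq> 0" "i < D" "b \<noteq> k i" for k i b
  proof (rule ccontr)
    assume "T (k(i := b)) \<noteq> 0"
    then have "Poly_Mapping.lookup w (exponent ({..<D} - {i}) k + Poly_Mapping.single b 1) \<noteq> 0"
      unfolding T_def tensor_of_form_def word_exponent_fun_upd[OF that(2)] by simp
    moreover have "Poly_Mapping.lookup w (exponent ({..<D} - {i}) k + Poly_Mapping.single (k i) 1) \<noteq> 0"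
      using that(1) unfolding T_def tensor_of_form_def word_exponent_fun_upd[OF that(2), symmetric] by simp
    ultimately show False using isolated that(3) by blast
  qed
  have m_eq: "m a = m b" for a b
  proof -
    obtain \<sigma> where \<sigma>: "bij \<sigma>" "\<sigma> a = b"
      "\<And>e. cmod (Poly_Mapping.lookup w (Poly_Mapping.map_key \<sigma> e)) = cmod (Poly_Mapping.lookup w e)"
      using transitive by blast
    have inj: "inj \<sigma>" and surj: "surj \<sigma>" using \<sigma>(1) by (auto simp: bij_def)
    \<comment> \<open>\<open>R\<close> is the action of the permutation of variables on words, and
      \<open>restrict\<close> keeps it within extensional functions.\<close>
    define R where "R k = restrict (\<lambda>i. \<sigma> (k i)) {..<D}" for k :: "nat \<Rightarrow> 'v"
    have bij: "bij_betw R (words D) (words D :: (nat \<Rightarrow> 'v) set)"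
    proof (rule bij_betwI[where g = "\<lambda>k. restrict (\<lambda>i. inv \<sigma> (k i)) {..<D}"])
      show "R \<in> words D \<rightarrow> words D" "(\<lambda>k. restrict (\<lambda>i. inv \<sigma> (k i)) {..<D}) \<in> words D \<rightarrow> words D"
        by (auto simp: R_def)
    next
      fix k :: "nat \<Rightarrow> 'v" assume "k \<in> words D"
      then show "restrict (\<lambda>i. inv \<sigma> (R k i)) {..<D} = k" "R (restrict (\<lambda>i. inv \<sigma> (k i)) {..<D}) = k"
        by (auto simp: R_def fun_eq_iff inv_f_f[OF inj] surj_f_inv_f[OF surj] PiE_iff extensional_def)
    qed
    have R_exp: "word_exponent D (R k) = word_exponent D (\<lambda>i. \<sigma> (k i))" for k
      by (rule exponent_cong) (simp add: R_def)
    have key: "Poly_Mapping.map_key \<sigma> (word_exponent D (R k)) = word_exponent D k" for k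
      unfolding R_exp by (rule map_key_exponent[OF finite_lessThan inj])
    have look: "Poly_Mapping.lookup (word_exponent D (R k)) (\<sigma> v) = Poly_Mapping.lookup (word_exponent D k) v" for k v
      unfolding R_exp by (simp add: lookup_exponent inj_eq[OF inj])
    have exp_eq: "word_exponent D (R l) = word_exponent D (R k) \<longleftrightarrow> word_exponent D l = word_exponent D k" for k l
    proof
      assume "word_exponent D (R l) = word_exponent D (R k)"
      then show "word_exponent D l = word_exponent D k" by (metis key)
    next
      assume eq: "word_exponent D l = word_exponent D k"
      show "word_exponent D (R l) = word_exponent D (R k)"
      proof (rule poly_mapping_eqI)
        fix v
        obtain u where "v = \<sigma> u" using surj by (rule surjE)
        then show "Poly_Mapping.lookup (word_exponent D (R l)) v = Poly_Mapping.lookup (word_exponent D (R k)) v"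
          by (simp only: look eq)
      qed
    qed
    have norm_T: "cmod (T (R k)) = cmod (T k)" if "k \<in> words D" for k
    proof -
      have "card {l \<in> words D. word_exponent D l = word_exponent D (R k)} =
          card {l \<in> words D. word_exponent D l = word_exponent D k}"
      proof -
        have "{l \<in> words D. word_exponent D l = word_exponent D (R k)} =
            R ` {l \<in> words D. word_exponent D l = word_exponent D k}"
          using bij_betw_imp_surj_on[OF bij] exp_eq by (auto 4 3)
        moreover have "inj_on R {l \<in> words D. word_exponent D l = word_exponent D k}"
          using bij_betw_imp_inj_on[OF bij] by (rule inj_on_subset) auto
        ultimately show ?thesis by (simp add: card_image)
      qed
      moreover have "cmod (Poly_Mapping.lookup w (word_exponent D (R k))) =
          cmod (Poly_Mapping.lookup w (word_exponent D k))"
        using \<sigma>(3)[of "word_exponent D (R k)"] by (simp only: key)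
      ultimately show ?thesis by (simp add: T_def tensor_of_form_def norm_divide)
    qed
    have "m b = (\<Sum>k\<in>words D. of_nat (card {i\<in>{..<D}. R k i = b}) * (cmod (T (R k)))\<^sup>2)"
      unfolding m_def by (rule sum.reindex_bij_betw[OF bij, symmetric])
    also have "\<dots> = m a"
      unfolding m_def
    proof (intro sum.cong refl arg_cong2[of _ _ _ _ "(*)"] arg_cong[of _ _ "\<lambda>x. x\<^sup>2"] norm_T)
      fix k :: "nat \<Rightarrow> 'v" assume "k \<in> words D"
      have "{i \<in> {..<D}. R k i = b} = {i \<in> {..<D}. k i = a}"
        by (auto simp: R_def \<sigma>(2)[symmetric] inj_eq[OF inj])
      then show "real (card {i \<in> {..<D}. R k i = b}) = real (card {i \<in> {..<D}. k i = a})"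
        by simp
    qed
    finally show ?thesis by simp
  qed
  define a0 :: 'v where "a0 = undefined"
  have "(\<Sum>i<D. tensor_inner D (slotwise D (slot i P) T) T) = of_real (m a0) * trace P" for P
  proof -
    have "slotwise D (slot i P) T k * cnj (T k) = P $ k i $ k i * of_real ((cmod (T k))\<^sup>2)"
      if k: "k \<in> words D" and i: "i < D" for i k
    proof (cases "T k = 0")
      case False
      have "slotwise D (slot i P) T k = (\<Sum>b\<in>UNIV. if b = k i then P $ k i $ k i * T k else 0)"
        unfolding slotwise_slot[OF k i] using off[OF False i] by (intro sum.cong) auto
      then show ?thesis by (simp add: complex_norm_square mult.assoc del: of_real_power)
    qed simp
    then have "(\<Sum>i<D. tensor_inner D (slotwise D (slot i P) T) T) =
        (\<Sum>i<D. \<Sum>k\<in>words D. P $ k i $ k i * of_real ((cmod (T k))\<^sup>2))"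
      unfolding tensor_inner_def by (intro sum.cong refl) auto
    also have "\<dots> = (\<Sum>k\<in>words D. (\<Sum>i<D. P $ k i $ k i) * of_real ((cmod (T k))\<^sup>2))"
      unfolding sum_distrib_right by (rule sum.swap)
    also have "\<dots> = (\<Sum>k\<in>words D. (\<Sum>a\<in>UNIV. of_nat (card {i\<in>{..<D}. k i = a}) * P $ a $ a) * of_real ((cmod (T k))\<^sup>2))"
    proof (intro sum.cong refl arg_cong2[of _ _ _ _ "(*)"])
      fix k :: "nat \<Rightarrow> 'v"
      have "(\<Sum>i<D. P $ k i $ k i) = (\<Sum>a\<in>UNIV. \<Sum>i\<in>{i\<in>{..<D}. k i = a}. P $ k i $ k i)"
        by (rule sum.group[symmetric]) auto
      also have "\<dots> = (\<Sum>a\<in>UNIV. of_nat (card {i\<in>{..<D}. k i = a}) * P $ a $ a)"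
        by (intro sum.cong refl) simp
      finally show "(\<Sum>i<D. P $ k i $ k i) = (\<Sum>a\<in>UNIV. of_nat (card {i\<in>{..<D}. k i = a}) * P $ a $ a)" .
    qed
    also have "\<dots> = (\<Sum>a\<in>UNIV. \<Sum>k\<in>words D. of_nat (card {i\<in>{..<D}. k i = a}) * P $ a $ a * of_real ((cmod (T k))\<^sup>2))"
      unfolding sum_distrib_right by (rule sum.swap)
    also have "\<dots> = (\<Sum>a\<in>UNIV. of_real (m a) * P $ a $ a)"
      unfolding m_def of_real_sum sum_distrib_right by (intro sum.cong refl) simp
    also have "\<dots> = of_real (m a0) * trace P"
      unfolding trace_def sum_distrib_left by (intro sum.cong refl) (metis m_eq)
    finally show ?thesis .
  qed
  then show ?thesis unfolding critical_def T_def by blast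
qed

theorem polystable_if_isolated_transitive:
  fixes w :: "'v::finite cpoly"
  assumes "w \<in> Sym D"
    and "\<And>e a b. Poly_Mapping.lookup w (e + Poly_Mapping.single a 1) \<noteq> 0 \<Longrightarrow>
      Poly_Mapping.lookup w (e + Poly_Mapping.single b 1) \<noteq> 0 \<Longrightarrow> a = b"
    and "\<And>a b. \<exists>\<sigma>. bij \<sigma> \<and> \<sigma> a = b \<and>
      (\<forall>e. cmod (Poly_Mapping.lookup w (Poly_Mapping.map_key \<sigma> e)) = cmod (Poly_Mapping.lookup w e))"
  shows "polystable D w"
  by (rule polystable_if_critical[OF assms(1) critical_tensor_of_form]) (fact assms)+

section \<open>Monomials, power sums, determinants and permanents\<close>

lemma single_exponent_in_Sym:
  fixes f :: "'i \<Rightarrow> 'v::finite"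
  assumes "finite I" shows "Poly_Mapping.single (exponent I f) c \<in> Sym (card I)"
  using assms by (auto simp: Sym_def degree_exponent)

lemma sum_in_Sym: "(\<And>i. i \<in> I \<Longrightarrow> p i \<in> Sym D) \<Longrightarrow> (\<Sum>i\<in>I. p i) \<in> Sym D"
proof (induction I rule: infinite_finite_induct)
  case (insert x F)
  then have "p x \<in> Sym D" "(\<Sum>i\<in>F. p i) \<in> Sym D" by auto
  then show ?case using insert.hyps keys_add[of "p x" "\<Sum>i\<in>F. p i"] by (auto simp: Sym_def)
qed (simp_all add: Sym_def)

lemma polystable_prod_Var: "polystable CARD('v::finite) (\<Prod>i\<in>UNIV. Var (i::'v))"
proof -
  define u :: "'v \<Rightarrow>\<^sub>0 nat" where "u = exponent UNIV (\<lambda>i. i)"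
  have w: "(\<Prod>i\<in>UNIV. Var (i::'v)) = Poly_Mapping.single u 1"
    using prod_Var[of "\<lambda>i. i" UNIV] by (simp add: u_def)
  have u: "e = u \<longleftrightarrow> (\<forall>i. Poly_Mapping.lookup e i = 1)" for e
    by (auto simp: poly_mapping_eq_iff fun_eq_iff u_def lookup_exponent)
  have norm_w: "cmod (Poly_Mapping.lookup (Poly_Mapping.single u 1) e) = (if e = u then 1 else 0)" for e
    by (simp add: lookup_single when_def)
  show ?thesis
    unfolding w
  proof (rule polystable_if_isolated_transitive)
    show "Poly_Mapping.single u 1 \<in> Sym CARD('v)"
      unfolding u_def by (rule single_exponent_in_Sym) simp
  next
    fix e and a b :: 'v
    assume "Poly_Mapping.lookup (Poly_Mapping.single u (1::complex)) (e + Poly_Mapping.single a 1) \<noteq> 0"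
      "Poly_Mapping.lookup (Poly_Mapping.single u (1::complex)) (e + Poly_Mapping.single b 1) \<noteq> 0"
    then have "e + Poly_Mapping.single a 1 = e + Poly_Mapping.single b 1"
      by (auto simp: lookup_single when_def split: if_splits)
    then have "Poly_Mapping.lookup (Poly_Mapping.single a (1::nat)) b = Poly_Mapping.lookup (Poly_Mapping.single b 1) b"
      by simp
    then show "a = b" by (simp add: lookup_single when_def split: if_splits)
  next
    fix a b :: 'v
    have "Poly_Mapping.map_key (Transposition.transpose a b) e = u \<longleftrightarrow> e = u" for e
      unfolding u by (simp add: map_key.rep_eq) (metis transpose_involutory)
    then show "\<exists>\<sigma>. bij \<sigma> \<and> \<sigma> a = b \<and>
      (\<forall>e. cmod (Poly_Mapping.lookup (Poly_Mapping.single u (1::complex)) (Poly_Mapping.map_key \<sigma> e)) =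
        cmod (Poly_Mapping.lookup (Poly_Mapping.single u (1::complex)) e))"
      by (intro exI[of _ "Transposition.transpose a b"]) (simp add: norm_w)
  qed
qed

text \<open>
  The hypothesis \<open>D > 1\<close> enters through the isolation of monomials: removing one
  factor from the \<open>D\<close>-th power of a variable leaves at least one factor, which
  identifies the variable.
\<close>

lemma polystable_power_sum:
  assumes "D > 1" shows "polystable D (\<Sum>i\<in>UNIV. Var (i::'v::finite) ^ D)"
proof -
  let ?w = "\<Sum>i\<in>UNIV. Var (i::'v) ^ D"
  have D_single: "word_exponent D (\<lambda>_. i) = Poly_Mapping.single i D" for i :: 'v
    by (rule poly_mapping_eqI) (simp add: lookup_exponent lookup_single when_def)
  have pow: "Var i ^ D = Poly_Mapping.single (Poly_Mapping.single i D) 1" for i :: 'v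
    using prod_Var[of "\<lambda>_. i" "{..<D}"] by (simp only: D_single prod_constant card_lessThan)
  have lookup_w: "Poly_Mapping.lookup ?w e = (if \<exists>i. e = Poly_Mapping.single i D then 1 else 0)" for e
  proof (cases "\<exists>i. e = Poly_Mapping.single i D")
    case True
    then obtain i where i: "e = Poly_Mapping.single i D" by blast
    have "j = i" if "Poly_Mapping.single j D = Poly_Mapping.single i D" for j :: 'v
      using assms arg_cong[OF that, of "\<lambda>e. Poly_Mapping.lookup e j"]
      by (simp add: lookup_single when_def split: if_splits)
    then have "Poly_Mapping.lookup ?w e = (\<Sum>j\<in>UNIV. if j = i then 1 else 0)"
      unfolding lookup_sum pow i by (intro sum.cong) (auto simp: lookup_single when_def)
    then show ?thesis using True by simp
  next
    case False
    then show ?thesis unfolding lookup_sum pow by (auto simp: lookup_single when_def intro!: sum.neutral)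
  qed
  show ?thesis
  proof (rule polystable_if_isolated_transitive)
    have "Poly_Mapping.single (word_exponent D (\<lambda>_. i)) 1 \<in> Sym D" for i :: 'v
      using single_exponent_in_Sym[of "{..<D}" "\<lambda>_. i"] by simp
    then show "?w \<in> Sym D"
      unfolding pow D_single by (intro sum_in_Sym)
  next
    fix e and a b :: 'v
    assume "Poly_Mapping.lookup ?w (e + Poly_Mapping.single a 1) \<noteq> 0"
      "Poly_Mapping.lookup ?w (e + Poly_Mapping.single b 1) \<noteq> 0"
    then obtain i j where i: "e + Poly_Mapping.single a 1 = Poly_Mapping.single i D"
      and j: "e + Poly_Mapping.single b 1 = Poly_Mapping.single j D"
      by (auto simp: lookup_w split: if_splits)
    have i': "Poly_Mapping.lookup e v + (if a = v then 1 else 0) = (if i = v then D else 0)" for v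
      using arg_cong[OF i, of "\<lambda>e. Poly_Mapping.lookup e v"] by (simp only: lookup_add lookup_single when_def)
    have j': "Poly_Mapping.lookup e v + (if b = v then 1 else 0) = (if j = v then D else 0)" for v
      using arg_cong[OF j, of "\<lambda>e. Poly_Mapping.lookup e v"] by (simp only: lookup_add lookup_single when_def)
    have "Poly_Mapping.lookup e a > 0" "Poly_Mapping.lookup e b > 0"
      using i'[of a] j'[of b] assms by (auto split: if_splits)
    then show "a = b"
      using i'[of a] i'[of b] by (auto split: if_splits)
  next
    fix a b :: 'v
    have "Poly_Mapping.map_key (Transposition.transpose a b) e = Poly_Mapping.single i D \<longleftrightarrow>
        e = Poly_Mapping.single (Transposition.transpose a b i) D" for e i
    proof -
      have "Poly_Mapping.map_key (Transposition.transpose a b) e = Poly_Mapping.single i D \<longleftrightarrow>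
          (\<forall>v. Poly_Mapping.lookup e (Transposition.transpose a b v) = (if v = i then D else 0))"
        by (auto simp: poly_mapping_eq_iff fun_eq_iff map_key.rep_eq lookup_single when_def)
      also have "\<dots> \<longleftrightarrow> (\<forall>v. Poly_Mapping.lookup e v = (if v = Transposition.transpose a b i then D else 0))"
        by (metis transpose_involutory)
      also have "\<dots> \<longleftrightarrow> e = Poly_Mapping.single (Transposition.transpose a b i) D"
        by (auto simp: poly_mapping_eq_iff fun_eq_iff lookup_single when_def)
      finally show ?thesis .
    qed
    then have "(\<exists>i. Poly_Mapping.map_key (Transposition.transpose a b) e = Poly_Mapping.single i D) \<longleftrightarrow>
        (\<exists>i. e = Poly_Mapping.single i D)" for e
      by (metis transpose_involutory)
    then show "\<exists>\<sigma>. bij \<sigma> \<and> \<sigma> a = b \<and>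
      (\<forall>e. cmod (Poly_Mapping.lookup ?w (Poly_Mapping.map_key \<sigma> e)) = cmod (Poly_Mapping.lookup ?w e))"
      by (intro exI[of _ "Transposition.transpose a b"]) (auto simp: lookup_w)
  qed
qed

definition perm_exponent :: "('n::finite \<Rightarrow> 'n) \<Rightarrow> ('n \<times> 'n) \<Rightarrow>\<^sub>0 nat" where
  "perm_exponent \<pi> = exponent UNIV (\<lambda>i. (i, \<pi> i))"

lemma lookup_perm_exponent:
  "Poly_Mapping.lookup (perm_exponent \<pi>) (i, j) = (if \<pi> i = j then 1 else 0)"
proof -
  have "{i'. (i', \<pi> i') = (i, j)} = (if \<pi> i = j then {i} else {})" by auto
  then show ?thesis by (simp add: perm_exponent_def lookup_exponent)
qed

lemma inj_perm_exponent: "perm_exponent \<pi> = perm_exponent \<rho> \<longleftrightarrow> \<pi> = \<rho>"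
proof
  assume eq: "perm_exponent \<pi> = perm_exponent \<rho>"
  show "\<pi> = \<rho>"
  proof
    fix i show "\<pi> i = \<rho> i"
      using arg_cong[OF eq, of "\<lambda>e. Poly_Mapping.lookup e (i, \<pi> i)"]
      by (simp add: lookup_perm_exponent split: if_splits)
  qed
qed simp

lemma map_key_perm_exponent:
  fixes \<pi> :: "'n::finite \<Rightarrow> 'n"
  shows "Poly_Mapping.map_key (map_prod (Transposition.transpose a a') (Transposition.transpose b b')) (perm_exponent \<pi>) =
    perm_exponent (Transposition.transpose b b' \<circ> \<pi> \<circ> Transposition.transpose a a')"
proof (rule poly_mapping_eqI)
  fix v :: "'n \<times> 'n"
  obtain i j where v: "v = (i, j)" by (rule prod.exhaust)
  have "inj (map_prod (Transposition.transpose a a') (Transposition.transpose b b'))"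
    by (intro prod.inj_map bij_is_inj bij_transpose)
  then have "Poly_Mapping.lookup (Poly_Mapping.map_key (map_prod (Transposition.transpose a a') (Transposition.transpose b b')) (perm_exponent \<pi>)) v
    = Poly_Mapping.lookup (perm_exponent \<pi>) (Transposition.transpose a a' i, Transposition.transpose b b' j)"
    by (simp add: map_key.rep_eq v)
  moreover have "x = Transposition.transpose b b' j \<longleftrightarrow> Transposition.transpose b b' x = j" for x
    by (metis transpose_involutory)
  then have "Poly_Mapping.lookup (perm_exponent \<pi>) (Transposition.transpose a a' i, Transposition.transpose b b' j) =
    Poly_Mapping.lookup (perm_exponent (Transposition.transpose b b' \<circ> \<pi> \<circ> Transposition.transpose a a')) v"
    unfolding lookup_perm_exponent v by simp
  ultimately show "Poly_Mapping.lookup (Poly_Mapping.map_key (map_prod (Transposition.transpose a a') (Transposition.transpose b b')) (perm_exponent \<pi>)) v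
    = Poly_Mapping.lookup (perm_exponent (Transposition.transpose b b' \<circ> \<pi> \<circ> Transposition.transpose a a')) v"
    by simp
qed

text \<open>
  Covers determinant and permanent together, since only the absolute values of the coefficients
  matter. Replacing a single entry of a permutation matrix by another one never gives a
  permutation matrix, and row and column transpositions act transitively on the entries.
\<close>

theorem polystable_signed_permanent:
  fixes s :: "('n::finite \<Rightarrow> 'n) \<Rightarrow> int"
  assumes s: "\<And>\<pi>. \<bar>s \<pi>\<bar> = 1"
  shows "polystable CARD('n)
    ((\<Sum>\<pi> | \<pi> permutes (UNIV :: 'n set). of_int (s \<pi>) * (\<Prod>i\<in>UNIV. Var (i, \<pi> i))) :: ('n \<times> 'n) cpoly)"
    (is "polystable _ ?w")
proof -
  have term_eq: "of_int (s \<pi>) * (\<Prod>i\<in>UNIV. Var (i, \<pi> i)) =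
      (Poly_Mapping.single (perm_exponent \<pi>) (of_int (s \<pi>)) :: ('n \<times> 'n) cpoly)" for \<pi>
    unfolding prod_Var perm_exponent_def[symmetric] single_of_int[symmetric] mult_single by simp
  have norm_w: "cmod (Poly_Mapping.lookup ?w e) =
      (if \<exists>\<pi>. \<pi> permutes UNIV \<and> e = perm_exponent \<pi> then 1 else 0)" for e
  proof (cases "\<exists>\<pi>. \<pi> permutes UNIV \<and> e = perm_exponent \<pi>")
    case True
    then obtain \<pi> where \<pi>: "\<pi> permutes UNIV" "e = perm_exponent \<pi>" by blast
    have "Poly_Mapping.lookup ?w e =
        (\<Sum>\<rho> | \<rho> permutes (UNIV :: 'n set). if \<rho> = \<pi> then of_int (s \<pi>) else 0)"
      unfolding term_eq lookup_sum \<pi>(2)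
      by (intro sum.cong) (auto simp: lookup_single when_def inj_perm_exponent)
    also have "\<dots> = of_int (s \<pi>)" using \<pi>(1) by simp
    finally have "cmod (Poly_Mapping.lookup ?w e) = of_int \<bar>s \<pi>\<bar>" by simp
    then show ?thesis using True s by simp
  next
    case False
    then have "Poly_Mapping.lookup ?w e = 0"
      unfolding term_eq lookup_sum by (intro sum.neutral) (auto simp: lookup_single when_def)
    then show ?thesis using False by simp
  qed
  show ?thesis
  proof (rule polystable_if_isolated_transitive)
    show "?w \<in> Sym CARD('n)"
      unfolding term_eq perm_exponent_def by (intro sum_in_Sym single_exponent_in_Sym) simp
  next
    fix e and a b :: "'n \<times> 'n"
    assume "Poly_Mapping.lookup ?w (e + Poly_Mapping.single a 1) \<noteq> 0"
      "Poly_Mapping.lookup ?w (e + Poly_Mapping.single b 1) \<noteq> 0"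
    then have "cmod (Poly_Mapping.lookup ?w (e + Poly_Mapping.single a 1)) \<noteq> 0"
      "cmod (Poly_Mapping.lookup ?w (e + Poly_Mapping.single b 1)) \<noteq> 0"
      by simp_all
    then obtain \<pi> \<rho> where \<pi>: "\<pi> permutes UNIV" "e + Poly_Mapping.single a 1 = perm_exponent \<pi>"
      and \<rho>: "\<rho> permutes UNIV" "e + Poly_Mapping.single b 1 = perm_exponent \<rho>"
      unfolding norm_w by (auto split: if_splits)
    have \<pi>': "Poly_Mapping.lookup e (i, j) + (if a = (i, j) then 1 else 0) = (if \<pi> i = j then 1 else 0)" for i j
      using arg_cong[OF \<pi>(2), of "\<lambda>e. Poly_Mapping.lookup e (i, j)"]
      by (simp only: lookup_add lookup_single when_def lookup_perm_exponent)
    have \<rho>': "Poly_Mapping.lookup e (i, j) + (if b = (i, j) then 1 else 0) = (if \<rho> i = j then 1 else 0)" for i j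
      using arg_cong[OF \<rho>(2), of "\<lambda>e. Poly_Mapping.lookup e (i, j)"]
      by (simp only: lookup_add lookup_single when_def lookup_perm_exponent)
    \<comment> \<open>If \<open>b \<noteq> a = (i, j)\<close>, then \<open>\<rho>\<close> has to
      make up for the missing entry \<open>a\<close> in row \<open>i\<close> and also in column
      \<open>j\<close>; a single new entry \<open>b\<close> cannot do both.\<close>
    show "a = b"
    proof (rule ccontr)
      assume ne: "a \<noteq> b"
      obtain i j where a: "a = (i, j)" by (rule prod.exhaust)
      have e0: "Poly_Mapping.lookup e (i, j) = 0" and \<pi>i: "\<pi> i = j"
        using \<pi>'[of i j] by (auto simp: a split: if_splits)
      have \<rho>i: "\<rho> i \<noteq> j"
        using \<rho>'[of i j] ne e0 by (auto simp: a split: if_splits)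
      have b: "b = (i, \<rho> i)"
        using \<rho>'[of i "\<rho> i"] \<pi>'[of i "\<rho> i"] \<pi>i \<rho>i by (auto split: if_splits)
      obtain i' where i': "\<rho> i' = j" using permutes_surj[OF \<rho>(1)] by (metis surjD)
      then have "i' \<noteq> i" using \<rho>i by auto
      then have "\<pi> i' \<noteq> j" using \<pi>i permutes_inj[OF \<pi>(1)] by (auto dest: injD)
      then show False
        using \<rho>'[of i' j] \<pi>'[of i' j] b i' \<open>i' \<noteq> i\<close> by (auto split: if_splits)
    qed
  next
    fix a b :: "'n \<times> 'n"
    define \<sigma> where "\<sigma> = map_prod (Transposition.transpose (fst a) (fst b)) (Transposition.transpose (snd a) (snd b))"
    have inv: "\<sigma> (\<sigma> v) = v" for v by (cases v) (simp add: \<sigma>_def)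
    then have bij: "bij \<sigma>" by (intro o_bij[of \<sigma>]) auto
    have imp: "\<exists>\<pi>. \<pi> permutes UNIV \<and> Poly_Mapping.map_key \<sigma> e = perm_exponent \<pi>"
      if ex: "\<exists>\<pi>. \<pi> permutes UNIV \<and> e = perm_exponent \<pi>" for e
    proof -
      obtain \<pi> where \<pi>: "\<pi> permutes UNIV" "e = perm_exponent \<pi>" using ex by blast
      show ?thesis
        unfolding \<sigma>_def \<pi>(2) map_key_perm_exponent
        by (rule exI, rule conjI[OF _ refl]) (intro permutes_compose permutes_swap_id \<pi>(1) UNIV_I)
    qed
    have invol: "Poly_Mapping.map_key \<sigma> (Poly_Mapping.map_key \<sigma> e) = e" for e :: "('n \<times> 'n) \<Rightarrow>\<^sub>0 nat"
      by (rule poly_mapping_eqI) (simp add: map_key.rep_eq bij_is_inj[OF bij] inv)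
    have orbit: "(\<exists>\<pi>. \<pi> permutes UNIV \<and> Poly_Mapping.map_key \<sigma> e = perm_exponent \<pi>) \<longleftrightarrow>
        (\<exists>\<pi>. \<pi> permutes UNIV \<and> e = perm_exponent \<pi>)" for e
      using imp[of e] imp[of "Poly_Mapping.map_key \<sigma> e"] unfolding invol by blast
    have "\<sigma> a = b" by (simp add: \<sigma>_def map_prod_def split_beta)
    then show "\<exists>\<sigma>. bij \<sigma> \<and> \<sigma> a = b \<and>
      (\<forall>e. cmod (Poly_Mapping.lookup ?w (Poly_Mapping.map_key \<sigma> e)) = cmod (Poly_Mapping.lookup ?w e))"
      using bij by (intro exI[of _ \<sigma>]) (simp add: norm_w orbit)
  qed
qed

theorem corollary2p9:
  "polystable CARD('m::finite) (\<Prod>i\<in>UNIV. Var (i::'m))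
   \<and> (\<forall>D::nat. D > 1 \<longrightarrow> polystable D (\<Sum>i\<in>UNIV. Var (i::'m) ^ D))
   \<and> polystable CARD('n::finite) (det_poly :: ('n \<times> 'n) cpoly)
   \<and> polystable CARD('n) (per_poly :: ('n \<times> 'n) cpoly)"
proof (intro conjI allI impI)
  show "polystable CARD('m) (\<Prod>i\<in>UNIV. Var (i::'m))" by (rule polystable_prod_Var)
  show "polystable D (\<Sum>i\<in>UNIV. Var (i::'m) ^ D)" if "D > 1" for D :: nat
    using that by (rule polystable_power_sum)
  show "polystable CARD('n) (det_poly :: ('n \<times> 'n) cpoly)"
    unfolding det_poly_def by (rule polystable_signed_permanent) (simp add: sign_def)
  show "polystable CARD('n) (per_poly :: ('n \<times> 'n) cpoly)"
    using polystable_signed_permanent[of "\<lambda>_. 1"] by (simp add: per_poly_def)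
qed

end
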